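(* Let $E$ be a finite directed graph with no sources, and let $(G,E)$ be a self-similar groupoid action. Then the following are equivalent. (1) The groupoid $\mathcal{G}_{G,E}$ is Hausdorff. (2) The subgroupoid $\mathcal{G}_{G,E}^{\mathbb{T}}:=\{[x,m,g,n,y]\in\mathcal{G}_{G,E}: m=n\}$ is Hausdorff. (3) The subgroupoid $\{[g\cdot x,0,g,0,x]: x\in E^\infty,\ g\in G,\ d(g)=r(x)\}$ is Hausdorff. (4) If $g\in G$ and $y\in E^\infty$ (with $r(y)=d(g)$) satisfy $g\cdot y=y$ and $g|_{y(0,n)}\neq s(y(0,n))$ for all $n\geq 0$, then there exists $\lambda\in E^*$ such that $y\in Z[\lambda)$ and no element of $\lambda E^*$ is strongly fixed by $g$. In particular, if $(G,E)$ is regular then $\mathcal{G}_{G,E}$ is Hausdorff.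
   Context: **Graphs.** A directed graph is $E=(E^0,E^1,r,s)$ with $r,s:E^1\to E^0$. Paths are $\mu=e_1\cdots e_n$ with $s(e_i)=r(e_{i+1})$; $r(\mu)=r(e_1)$, $s(\mu)=s(e_n)$ (for a vertex $v$, $r(v)=s(v)=v$); $E^*$ is the set of all finite paths including vertices, $vE^*$ those with range $v$, $vE^1$ the edges with range $v$, and $\lambda E^*$ the set of paths extending $\lambda$ on the right. No sources: $vE^1\ne\emptyset$ for all $v$. $E^\infty$ is the set of right-infinite paths $x=x_1x_2\cdots$ with $s(x_i)=r(x_{i+1})$, $r(x)=r(x_1)$; $Z[\mu)$ is the set of $x\in E^\infty$ with initial segment $\mu$; these form a basis for the topology. For $n\le l$, $y(n,l)=y_{n+1}\cdots y_l$ (the vertex $r(y_{n+1})$ if $n=l$). $\varsigma(x_1x_2\cdots)=x_2x_3\cdots$. **Self-similar groupoid actions.** Let $E$ be a finite graph with no sources. A partial isomorphism of $E^*$ is a length-preserving bijection $g:vE^*\to wE^*$ with $g(\mu e)\in g(\mu)E^1$; $d(g)=v$, $c(g)=w$. These form a groupoid $\mathrm{PIso}(E^* )$ with unit space $E^0$. A self-similar groupoid action $(G,E)$ is a groupoid $G$ with unit space $E^0$ and an injective homomorphism $G\to\mathrm{PIso}(E^* )$, identity on $E^0$ (written $g\cdot\mu$), such that for all $g\in G$, $e\in d(g)E^1$ there is a (necessarily unique) $g|_e\in G$ with $d(g|_e)=s(e)$, $c(g|_e)=s(g\cdot e)$, $g\cdot(e\mu)=(g\cdot e)(g|_e\cdot\mu)$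 for all $\mu\in s(e)E^*$. Put $g|_{d(g)}=g$, $g|_{e\mu}=(g|_e)|_\mu$. $G$ acts on $E^\infty$ via initial segments. A path $\lambda$ is strongly fixed by $g$ (with $d(g)=r(\lambda)$) if $g\cdot\lambda=\lambda$ and $g|_\lambda=s(\lambda)$. Regular: whenever $g\cdot y=y$ with $g\in G$, $y\in E^\infty$, $r(y)=d(g)$, some initial segment of $y$ is strongly fixed by $g$. **The groupoid $\mathcal{G}_{G,E}$.** On tuples $(x,m,g,n,y)\in E^\infty\times\mathbb{N}\times G\times\mathbb{N}\times E^\infty$ ($0\in\mathbb{N}$) with $d(g)=r(\varsigma^n(y))$ and $\varsigma^m(x)=g\cdot\varsigma^n(y)$, put $(x,m,g,n,y)\sim(w,p,h,q,z)$ iff $x=w$, $y=z$, $m-n=p-q$ and $g|_{y(n,l)}=h|_{y(q,l)}$ for some $l\ge\max\{n,q\}$. $\mathcal{G}_{G,E}$ is the set of classes $[x,m,g,n,y]$, with range $x$, source $y$, product $[x,m,g,n,y][y,p,h,q,z]=[x,m+p,g|_{y(n,n+p)}h|_{z(q,q+n)},n+q,z]$, inverse $[y,n,g^{-1},m,x]$, and units $[x,0,r(x),0,x]$ identified with $x\in E^\infty$. Its topology has as basis the sets $Z(\mu,g,\nu)=\{[\mu(g\cdot y),|\mu|,g,|\nu|,\nu y]: y\in E^\infty,\ r(y)=s(\nu)\}$ for $\mu,\nu\in E^*$, $g\in G$ with $s(\mu)=c(g)$, $s(\nu)=d(g)$. Subgroupoids carry the subspace topology. *)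

theory Defs
  imports "HOL-Analysis.Analysis" "HOL-Library.Omega_Words_Fun" "Graph_Theory.Digraph"
begin

text \<open>
  A directed graph with range map \<open>r\<close> and source map \<open>s\<close> is a \<open>pre_digraph\<close>, with
  \<open>r = head E\<close> and \<open>s = tail E\<close>.  Paths are traversed against the arrows: consecutive edges
  \<open>e, f\<close> satisfy \<open>tail E e = head E f\<close>.
\<close>

definition no_sources :: "('v,'e) pre_digraph \<Rightarrow> bool" where
  "no_sources E \<longleftrightarrow> (\<forall>v\<in>verts E. \<exists>e\<in>arcs E. head E e = v)"


section \<open>Finite and infinite paths\<close>

text \<open>
  A finite path is stored as its range together with its list of edges, so that the vertex
  \<open>v\<close>, regarded as a path of length \<open>0\<close>, is \<open>(v, [])\<close>.  An infinite path is the sequence of its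
  edges; the index set starts at \<open>0\<close>, so that the edge written \<open>x\<^sub>i\<^sub>+\<^sub>1\<close> on paper is \<open>x i\<close>.
\<close>

type_synonym ('v,'e) epath = "'v \<times> 'e list"

primrec chain :: "('v,'e) pre_digraph \<Rightarrow> 'v \<Rightarrow> 'e list \<Rightarrow> bool" where
  "chain E v [] \<longleftrightarrow> v \<in> verts E"
| "chain E v (e # es) \<longleftrightarrow> e \<in> arcs E \<and> head E e = v \<and> chain E (tail E e) es"

definition fpaths :: "('v,'e) pre_digraph \<Rightarrow> ('v,'e) epath set" where
  "fpaths E = {\<mu>. chain E (fst \<mu>) (snd \<mu>)}"

definition rng :: "('v,'e) epath \<Rightarrow> 'v" where
  "rng \<mu> = fst \<mu>"

definition src :: "('v,'e) pre_digraph \<Rightarrow> ('v,'e) epath \<Rightarrow> 'v" where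
  "src E \<mu> = (if snd \<mu> = [] then fst \<mu> else tail E (last (snd \<mu>)))"

definition plen :: "('v,'e) epath \<Rightarrow> nat" where
  "plen \<mu> = length (snd \<mu>)"

definition edge_path :: "('v,'e) pre_digraph \<Rightarrow> 'e \<Rightarrow> ('v,'e) epath" where
  "edge_path E e = (head E e, [e])"

definition pcat :: "('v,'e) epath \<Rightarrow> ('v,'e) epath \<Rightarrow> ('v,'e) epath" where
  "pcat \<mu> \<nu> = (rng \<mu>, snd \<mu> @ snd \<nu>)"

definition paths_at :: "('v,'e) pre_digraph \<Rightarrow> 'v \<Rightarrow> ('v,'e) epath set" where
  "paths_at E v = {\<mu> \<in> fpaths E. rng \<mu> = v}"

definition edges_at :: "('v,'e) pre_digraph \<Rightarrow> 'v \<Rightarrow> 'e set" where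
  "edges_at E v = {e \<in> arcs E. head E e = v}"

definition extensions :: "('v,'e) pre_digraph \<Rightarrow> ('v,'e) epath \<Rightarrow> ('v,'e) epath set" where
  "extensions E \<mu> = {pcat \<mu> \<nu> | \<nu>. \<nu> \<in> paths_at E (src E \<mu>)}"

definition ipaths :: "('v,'e) pre_digraph \<Rightarrow> 'e word set" where
  "ipaths E = {x. \<forall>i. x i \<in> arcs E \<and> tail E (x i) = head E (x (Suc i))}"

definition irng :: "('v,'e) pre_digraph \<Rightarrow> 'e word \<Rightarrow> 'v" where
  "irng E x = head E (x 0)"

text \<open>The path \<open>y(n,l) = y\<^sub>n\<^sub>+\<^sub>1 \<dots> y\<^sub>l\<close>, for \<open>n \<le> l\<close>.\<close>

definition seg :: "('v,'e) pre_digraph \<Rightarrow> 'e word \<Rightarrow> nat \<Rightarrow> nat \<Rightarrow> ('v,'e) epath" where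
  "seg E y n l = (head E (y n), y [n \<rightarrow> l])"

definition cylinder :: "('v,'e) pre_digraph \<Rightarrow> ('v,'e) epath \<Rightarrow> 'e word set" where
  "cylinder E \<mu> = {x \<in> ipaths E. seg E x 0 (plen \<mu>) = \<mu>}"


section \<open>Groupoids\<close>

text \<open>
  The units form the set \<open>gunit G ` objs G\<close>; the product \<open>gmul G a b\<close> is meaningful when
  \<open>gdom G a = gcod G b\<close>.  A groupoid with unit space \<open>X\<close> is one with \<open>objs G = X\<close>, the point
  \<open>v \<in> X\<close> being identified with the arrow \<open>gunit G v\<close>.
\<close>

record ('o,'a) groupoid =
  objs :: "'o set"
  arrs :: "'a set"
  gdom :: "'a \<Rightarrow> 'o"
  gcod :: "'a \<Rightarrow> 'o"
  gunit :: "'o \<Rightarrow> 'a"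
  gmul :: "'a \<Rightarrow> 'a \<Rightarrow> 'a"
  ginv :: "'a \<Rightarrow> 'a"

locale groupoid =
  fixes G :: "('o,'a) groupoid"
  assumes gdom_in: "a \<in> arrs G \<Longrightarrow> gdom G a \<in> objs G"
    and gcod_in: "a \<in> arrs G \<Longrightarrow> gcod G a \<in> objs G"
    and gunit_in: "v \<in> objs G \<Longrightarrow> gunit G v \<in> arrs G"
    and gdom_unit: "v \<in> objs G \<Longrightarrow> gdom G (gunit G v) = v"
    and gcod_unit: "v \<in> objs G \<Longrightarrow> gcod G (gunit G v) = v"
    and gmul_in: "\<lbrakk>a \<in> arrs G; b \<in> arrs G; gdom G a = gcod G b\<rbrakk> \<Longrightarrow> gmul G a b \<in> arrs G"
    and gdom_mul: "\<lbrakk>a \<in> arrs G; b \<in> arrs G; gdom G a = gcod G b\<rbrakk>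
                   \<Longrightarrow> gdom G (gmul G a b) = gdom G b"
    and gcod_mul: "\<lbrakk>a \<in> arrs G; b \<in> arrs G; gdom G a = gcod G b\<rbrakk>
                   \<Longrightarrow> gcod G (gmul G a b) = gcod G a"
    and gmul_assoc: "\<lbrakk>a \<in> arrs G; b \<in> arrs G; c \<in> arrs G;
                      gdom G a = gcod G b; gdom G b = gcod G c\<rbrakk>
                   \<Longrightarrow> gmul G (gmul G a b) c = gmul G a (gmul G b c)"
    and gmul_unit_right: "a \<in> arrs G \<Longrightarrow> gmul G a (gunit G (gdom G a)) = a"
    and gmul_unit_left: "a \<in> arrs G \<Longrightarrow> gmul G (gunit G (gcod G a)) a = a"
    and ginv_in: "a \<in> arrs G \<Longrightarrow> ginv G a \<in> arrs G"
    and gdom_inv: "a \<in> arrs G \<Longrightarrow> gdom G (ginv G a) = gcod G a"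
    and gcod_inv: "a \<in> arrs G \<Longrightarrow> gcod G (ginv G a) = gdom G a"
    and gmul_inv_right: "a \<in> arrs G \<Longrightarrow> gmul G a (ginv G a) = gunit G (gcod G a)"
    and gmul_inv_left: "a \<in> arrs G \<Longrightarrow> gmul G (ginv G a) a = gunit G (gdom G a)"

definition groupoid_hom :: "('o,'a) groupoid \<Rightarrow> ('p,'b) groupoid \<Rightarrow> ('a \<Rightarrow> 'b) \<Rightarrow> bool" where
  "groupoid_hom G H \<phi> \<longleftrightarrow>
     (\<forall>a\<in>arrs G. \<phi> a \<in> arrs H) \<and>
     (\<forall>a\<in>arrs G. \<forall>b\<in>arrs G. gdom G a = gcod G b \<longrightarrow>
        gdom H (\<phi> a) = gcod H (\<phi> b) \<and> \<phi> (gmul G a b) = gmul H (\<phi> a) (\<phi> b))"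


section \<open>Partial isomorphisms and self-similar groupoid actions\<close>

text \<open>
  A partial isomorphism \<open>vE\<^sup>* \<rightarrow> wE\<^sup>*\<close> is a triple \<open>(w, f, v)\<close>; the underlying function is
  made \<open>undefined\<close> outside \<open>vE\<^sup>*\<close>, so that equality of triples is equality of partial maps.
\<close>

type_synonym ('v,'e) piso = "'v \<times> (('v,'e) epath \<Rightarrow> ('v,'e) epath) \<times> 'v"

definition is_piso :: "('v,'e) pre_digraph \<Rightarrow> ('v,'e) piso \<Rightarrow> bool" where
  "is_piso E = (\<lambda>(w, f, v).
     v \<in> verts E \<and> w \<in> verts E \<and>
     f \<in> extensional (paths_at E v) \<and>
     bij_betw f (paths_at E v) (paths_at E w) \<and>
     (\<forall>\<mu>\<in>paths_at E v. plen (f \<mu>) = plen \<mu>) \<and>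
     (\<forall>\<mu>\<in>paths_at E v. \<forall>e\<in>edges_at E (src E \<mu>).
        f (pcat \<mu> (edge_path E e)) \<in> {pcat (f \<mu>) (edge_path E e') | e'. e' \<in> edges_at E (src E (f \<mu>))}))"

definition PIso :: "('v,'e) pre_digraph \<Rightarrow> ('v, ('v,'e) piso) groupoid" where
  "PIso E = \<lparr> objs = verts E,
     arrs = {p. is_piso E p},
     gdom = (\<lambda>(w, f, v). v),
     gcod = (\<lambda>(w, f, v). w),
     gunit = (\<lambda>v. (v, restrict id (paths_at E v), v)),
     gmul = (\<lambda>(u, f, w') (w, g, v). (u, compose (paths_at E v) f g, v)),
     ginv = (\<lambda>(w, f, v). (v, restrict (inv_into (paths_at E v) f) (paths_at E w), w)) \<rparr>"

text \<open>
  In the following, \<open>\<phi>\<close> is the homomorphism from \<open>G\<close> to \<open>PIso E\<close>, and \<open>act \<phi> g \<mu>\<close> is \<open>g \<cdot> \<mu>\<close>.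
\<close>

definition act :: "('g \<Rightarrow> ('v,'e) piso) \<Rightarrow> 'g \<Rightarrow> ('v,'e) epath \<Rightarrow> ('v,'e) epath" where
  "act \<phi> g = fst (snd (\<phi> g))"

definition is_restriction ::
  "('v,'e) pre_digraph \<Rightarrow> ('v,'g) groupoid \<Rightarrow> ('g \<Rightarrow> ('v,'e) piso) \<Rightarrow> 'g \<Rightarrow> 'e \<Rightarrow> 'g \<Rightarrow> bool" where
  "is_restriction E G \<phi> g e h \<longleftrightarrow>
     h \<in> arrs G \<and> gdom G h = tail E e \<and> gcod G h = src E (act \<phi> g (edge_path E e)) \<and>
     (\<forall>\<mu>\<in>paths_at E (tail E e).
        act \<phi> g (pcat (edge_path E e) \<mu>) = pcat (act \<phi> g (edge_path E e)) (act \<phi> h \<mu>))"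

locale self_similar_action = groupoid G
  for E :: "('v,'e) pre_digraph" and G :: "('v,'g) groupoid" and \<phi> :: "'g \<Rightarrow> ('v,'e) piso" +
  assumes unit_space: "objs G = verts E"
    and hom: "groupoid_hom G (PIso E) \<phi>"
    and inj: "inj_on \<phi> (arrs G)"
    and hom_unit: "v \<in> verts E \<Longrightarrow> \<phi> (gunit G v) = gunit (PIso E) v"
    and self_similar: "\<lbrakk>g \<in> arrs G; e \<in> edges_at E (gdom G g)\<rbrakk> \<Longrightarrow> \<exists>h. is_restriction E G \<phi> g e h"

definition restr_edge ::
  "('v,'e) pre_digraph \<Rightarrow> ('v,'g) groupoid \<Rightarrow> ('g \<Rightarrow> ('v,'e) piso) \<Rightarrow> 'g \<Rightarrow> 'e \<Rightarrow> 'g" where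
  "restr_edge E G \<phi> g e = (THE h. is_restriction E G \<phi> g e h)"

definition restr ::
  "('v,'e) pre_digraph \<Rightarrow> ('v,'g) groupoid \<Rightarrow> ('g \<Rightarrow> ('v,'e) piso) \<Rightarrow> 'g \<Rightarrow> ('v,'e) epath \<Rightarrow> 'g" where
  "restr E G \<phi> g \<mu> = foldl (restr_edge E G \<phi>) g (snd \<mu>)"

text \<open>
  The action on infinite paths is the one determined by
  \<open>seg E (iact E \<phi> g x) 0 n = act \<phi> g (seg E x 0 n)\<close> for all \<open>n\<close>: as \<open>g\<close> preserves lengths and
  initial segments, the edge number \<open>i\<close> of \<open>g \<cdot> x\<close> is the last edge of \<open>g \<cdot> x(0,i+1)\<close>.
\<close>

definition iact :: "('v,'e) pre_digraph \<Rightarrow> ('g \<Rightarrow> ('v,'e) piso) \<Rightarrow> 'g \<Rightarrow> 'e word \<Rightarrow> 'e word" where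
  "iact E \<phi> g x = (\<lambda>i. last (snd (act \<phi> g (seg E x 0 (Suc i)))))"

definition strongly_fixed ::
  "('v,'e) pre_digraph \<Rightarrow> ('v,'g) groupoid \<Rightarrow> ('g \<Rightarrow> ('v,'e) piso) \<Rightarrow> 'g \<Rightarrow> ('v,'e) epath \<Rightarrow> bool" where
  "strongly_fixed E G \<phi> g \<mu> \<longleftrightarrow>
     gdom G g = rng \<mu> \<and> act \<phi> g \<mu> = \<mu> \<and> restr E G \<phi> g \<mu> = gunit G (src E \<mu>)"

definition regular_action ::
  "('v,'e) pre_digraph \<Rightarrow> ('v,'g) groupoid \<Rightarrow> ('g \<Rightarrow> ('v,'e) piso) \<Rightarrow> bool" where
  "regular_action E G \<phi> \<longleftrightarrow>
     (\<forall>g\<in>arrs G. \<forall>y\<in>ipaths E. irng E y = gdom G g \<and> iact E \<phi> g y = y \<longrightarrow>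
        (\<exists>n. strongly_fixed E G \<phi> g (seg E y 0 n)))"


section \<open>The groupoid of a self-similar action\<close>

type_synonym ('e,'g) tup = "'e word \<times> nat \<times> 'g \<times> nat \<times> 'e word"

definition tuples ::
  "('v,'e) pre_digraph \<Rightarrow> ('v,'g) groupoid \<Rightarrow> ('g \<Rightarrow> ('v,'e) piso) \<Rightarrow> ('e,'g) tup set" where
  "tuples E G \<phi> = {(x, m, g, n, y).
     x \<in> ipaths E \<and> g \<in> arrs G \<and> y \<in> ipaths E \<and>
     gdom G g = irng E (suffix n y) \<and> suffix m x = iact E \<phi> g (suffix n y)}"

definition tuple_rel ::
  "('v,'e) pre_digraph \<Rightarrow> ('v,'g) groupoid \<Rightarrow> ('g \<Rightarrow> ('v,'e) piso) \<Rightarrow> ('e,'g) tup rel" where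
  "tuple_rel E G \<phi> = {((x, m, g, n, y), (w, p, h, q, z)).
     (x, m, g, n, y) \<in> tuples E G \<phi> \<and> (w, p, h, q, z) \<in> tuples E G \<phi> \<and>
     x = w \<and> y = z \<and> int m - int n = int p - int q \<and>
     (\<exists>l\<ge>max n q. restr E G \<phi> g (seg E y n l) = restr E G \<phi> h (seg E y q l))}"

text \<open>
  \<open>cls E G \<phi> (x, m, g, n, y)\<close> is \<open>[x, m, g, n, y]\<close>; it is empty, hence not an arrow of the
  groupoid below, when the argument is not in \<open>tuples E G \<phi>\<close>.
\<close>

definition cls ::
  "('v,'e) pre_digraph \<Rightarrow> ('v,'g) groupoid \<Rightarrow> ('g \<Rightarrow> ('v,'e) piso) \<Rightarrow> ('e,'g) tup \<Rightarrow> ('e,'g) tup set" where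
  "cls E G \<phi> t = tuple_rel E G \<phi> `` {t}"

text \<open>
  The structure maps are given by formulas on representatives; \<open>THE\<close> extracts the common value.
\<close>

definition ss_groupoid ::
  "('v,'e) pre_digraph \<Rightarrow> ('v,'g) groupoid \<Rightarrow> ('g \<Rightarrow> ('v,'e) piso) \<Rightarrow> ('e word, ('e,'g) tup set) groupoid" where
  "ss_groupoid E G \<phi> = \<lparr> objs = ipaths E,
     arrs = tuples E G \<phi> // tuple_rel E G \<phi>,
     gdom = (\<lambda>C. THE y. \<exists>x m g n. (x, m, g, n, y) \<in> C),
     gcod = (\<lambda>C. THE x. \<exists>m g n y. (x, m, g, n, y) \<in> C),
     gunit = (\<lambda>x. cls E G \<phi> (x, 0, gunit G (irng E x), 0, x)),
     gmul = (\<lambda>C D. THE K. \<exists>x m g n y p h q z.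
        (x, m, g, n, y) \<in> C \<and> (y, p, h, q, z) \<in> D \<and>
        K = cls E G \<phi> (x, m + p,
              gmul G (restr E G \<phi> g (seg E y n (n + p))) (restr E G \<phi> h (seg E z q (q + n))),
              n + q, z)),
     ginv = (\<lambda>C. THE K. \<exists>x m g n y. (x, m, g, n, y) \<in> C \<and> K = cls E G \<phi> (y, n, ginv G g, m, x)) \<rparr>"

definition Zset ::
  "('v,'e) pre_digraph \<Rightarrow> ('v,'g) groupoid \<Rightarrow> ('g \<Rightarrow> ('v,'e) piso) \<Rightarrow>
   ('v,'e) epath \<Rightarrow> 'g \<Rightarrow> ('v,'e) epath \<Rightarrow> ('e,'g) tup set set" where
  "Zset E G \<phi> \<mu> g \<nu> =
     {cls E G \<phi> (snd \<mu> \<frown> iact E \<phi> g y, plen \<mu>, g, plen \<nu>, snd \<nu> \<frown> y) | y.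
        y \<in> ipaths E \<and> irng E y = src E \<nu>}"

text \<open>
  For a self-similar action of a finite graph the sets \<open>Zset E G \<phi> \<mu> g \<nu>\<close> cover
  \<open>arrs (ss_groupoid E G \<phi>)\<close> and form a basis, so the topology they generate consists of
  their unions and its \<open>topspace\<close> is the set of all arrows.
\<close>

definition ss_topology ::
  "('v,'e) pre_digraph \<Rightarrow> ('v,'g) groupoid \<Rightarrow> ('g \<Rightarrow> ('v,'e) piso) \<Rightarrow> ('e,'g) tup set topology" where
  "ss_topology E G \<phi> = topology_generated_by
     {Zset E G \<phi> \<mu> g \<nu> | \<mu> g \<nu>.
        \<mu> \<in> fpaths E \<and> \<nu> \<in> fpaths E \<and> g \<in> arrs G \<and> src E \<mu> = gcod G g \<and> src E \<nu> = gdom G g}"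

definition core_arrs ::
  "('v,'e) pre_digraph \<Rightarrow> ('v,'g) groupoid \<Rightarrow> ('g \<Rightarrow> ('v,'e) piso) \<Rightarrow> ('e,'g) tup set set" where
  "core_arrs E G \<phi> =
     {cls E G \<phi> (x, m, g, n, y) | x m g n y.
        cls E G \<phi> (x, m, g, n, y) \<in> arrs (ss_groupoid E G \<phi>) \<and> m = n}"

definition transformation_arrs ::
  "('v,'e) pre_digraph \<Rightarrow> ('v,'g) groupoid \<Rightarrow> ('g \<Rightarrow> ('v,'e) piso) \<Rightarrow> ('e,'g) tup set set" where
  "transformation_arrs E G \<phi> =
     {cls E G \<phi> (iact E \<phi> g x, 0, g, 0, x) | g x. x \<in> ipaths E \<and> g \<in> arrs G \<and> gdom G g = irng E x}"

end

theory Submission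
  imports Defs
begin

text \<open>
  Two arrows with different range, source or degree are separated by sets \<open>Z(\<mu>, g, \<nu>)\<close> with
  long \<open>\<mu>\<close> and \<open>\<nu>\<close>.  Otherwise they can be written \<open>[x, m, g, n, y]\<close> and \<open>[x, m, h, n, y]\<close>,
  and \<open>h\<^sup>-\<^sup>1g\<close> fixes \<open>\<sigma>\<^sup>n(y)\<close>, where \<open>\<sigma>\<close> is the shift; an arrow common to two basic neighbourhoods that fix initial
  segments of length \<open>k\<close> produces a path that extends \<open>\<sigma>\<^sup>n(y)(0,k)\<close> and is strongly fixed by
  \<open>h\<^sup>-\<^sup>1g\<close>.  So (4) implies (1).  Conversely, when (4) fails at \<open>g\<close> and \<open>y\<close>, there are
  \<open>z \<rightarrow> y\<close> having initial segments strongly fixed by \<open>g\<close>, and then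
  \<open>[g \<cdot> z, 0, g, 0, z] = [z, 0, r(z), 0, z]\<close> converges both to \<open>[y, 0, g, 0, y]\<close> and to the
  different arrow \<open>[y, 0, r(y), 0, y]\<close>.
\<close>

section \<open>Finite and infinite paths of a directed graph\<close>

lemma src_Nil [simp]: "src E (v, []) = v"
  and src_Cons [simp]: "src E (v, e # es) = src E (tail E e, es)"
  and rng_Pair [simp]: "rng (v, es) = v"
  and plen_Pair [simp]: "plen (v, es) = length es"
  and pcat_Pair [simp]: "pcat (v, es) (w, fs) = (v, es @ fs)"
  by (auto simp: src_def rng_def plen_def pcat_def)

lemma src_append [simp]: "src E (v, es @ fs) = src E (src E (v, es), fs)"
  by (induction es arbitrary: v) auto

lemma chain_in_verts:
  assumes "wf_digraph E" "chain E v es"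
  shows "v \<in> verts E"
  using assms by (cases es) (auto simp: wf_digraph.head_in_verts)

lemma chain_src_in_verts: "chain E v es \<Longrightarrow> src E (v, es) \<in> verts E"
  by (induction es arbitrary: v) auto

lemma chain_append:
  assumes "wf_digraph E"
  shows "chain E v (es @ fs) \<longleftrightarrow> chain E v es \<and> chain E (src E (v, es)) fs"
  using chain_in_verts[OF assms] by (induction es arbitrary: v) auto

lemma fpaths_Pair [simp]: "(v, es) \<in> fpaths E \<longleftrightarrow> chain E v es"
  by (simp add: fpaths_def)

lemma paths_at_Pair [simp]: "(v, es) \<in> paths_at E w \<longleftrightarrow> v = w \<and> chain E v es"
  by (auto simp: paths_at_def)

lemma paths_atE:
  assumes "\<mu> \<in> paths_at E v"
  obtains es where "\<mu> = (v, es)" "chain E v es"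
  using assms by (cases \<mu>) auto

lemma seg_0 [simp]: "seg E x 0 n = (irng E x, prefix n x)"
  by (simp add: seg_def irng_def)

text \<open>The rule \<open>subseq_to_Suc\<close> splits off the last letter, whereas
  \<open>chain\<close> recurses on the first edge; inductions along a path need the unfolding at the
  front.\<close>

lemma prefix_Suc_Cons: "prefix (Suc n) x = x 0 # prefix n (suffix 1 x)"
  by (rule nth_equalityI) (auto simp: nth_Cons simp del: subseq_to_Suc split: nat.split)

lemma prefix_add: "prefix (m + n) x = prefix m x @ prefix n (suffix m x)"
  by (simp add: subsequence_append)

lemma word_eqI_prefix:
  assumes "\<And>n. prefix n x = prefix n y"
  shows "x = y"
proof
  fix i
  have "prefix (Suc i) x ! i = prefix (Suc i) y ! i"
    using assms by simp
  then show "x i = y i"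
    by (simp del: subseq_to_Suc)
qed

lemma ipaths_suffix: "x \<in> ipaths E \<Longrightarrow> suffix n x \<in> ipaths E"
  by (simp add: ipaths_def)

lemma chain_prefix:
  assumes "wf_digraph E" "x \<in> ipaths E"
  shows "chain E (irng E x) (prefix n x)"
  using assms(2)
proof (induction n arbitrary: x)
  case 0
  then show ?case
    using assms(1) by (auto simp: irng_def ipaths_def wf_digraph.head_in_verts)
next
  case (Suc n)
  have "chain E (irng E (suffix 1 x)) (prefix n (suffix 1 x))"
    using Suc.IH ipaths_suffix[OF Suc.prems] by blast
  then show ?case
    using Suc.prems by (simp add: prefix_Suc_Cons irng_def ipaths_def del: subseq_to_Suc)
qed

lemma src_prefix:
  assumes "x \<in> ipaths E"
  shows "src E (irng E x, prefix n x) = irng E (suffix n x)"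
proof (cases n)
  case (Suc k)
  then show ?thesis
    using assms by (simp add: irng_def ipaths_def)
qed (simp add: irng_def)

lemma conc_in_ipaths:
  assumes "chain E v es" "x \<in> ipaths E" "irng E x = src E (v, es)"
  shows "es \<frown> x \<in> ipaths E \<and> irng E (es \<frown> x) = v"
  using assms
proof (induction es arbitrary: v)
  case (Cons e es)
  then have "es \<frown> x \<in> ipaths E" "irng E (es \<frown> x) = tail E e"
    by auto
  \<comment> \<open>For \<open>i = 0\<close> this is the joint between \<open>e\<close> and the
    rest; for larger \<open>i\<close> it is inherited from \<open>es \<frown> x\<close>.\<close>
  then have "tail E ((e ## es \<frown> x) i) = head E ((e ## es \<frown> x) (Suc i))" "(e ## es \<frown> x) i \<in> arcs E" for i
    using Cons.prems by (cases i; auto simp: ipaths_def irng_def)+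
  then show ?case
    using Cons.prems by (simp add: ipaths_def irng_def)
qed (simp add: irng_def)

text \<open>Choose for each vertex \<open>w\<close> an edge \<open>p w\<close> with range
  \<open>w\<close>, and follow the chosen edges from \<open>v\<close>, passing each time to the
  source.\<close>

lemma ex_ipath_at:
  assumes "wf_digraph E" "no_sources E" "v \<in> verts E"
  obtains x where "x \<in> ipaths E" "irng E x = v"
proof -
  obtain p where p: "\<And>w. w \<in> verts E \<Longrightarrow> p w \<in> arcs E \<and> head E (p w) = w"
    using assms(2) unfolding no_sources_def by metis
  \<comment> \<open>\<open>V n\<close> is the vertex reached after \<open>n\<close> chosen
    edges.\<close>
  define V where "V n = ((\<lambda>w. tail E (p w)) ^^ n) v" for n
  have V: "V n \<in> verts E" for n
    using assms(3) p wf_digraph.tail_in_verts[OF assms(1)] by (induction n) (auto simp: V_def)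
  have "(\<lambda>n. p (V n)) \<in> ipaths E"
    using p V by (auto simp: ipaths_def) (metis V V_def comp_apply funpow.simps(2) p)
  moreover have "irng E (\<lambda>n. p (V n)) = v"
    using p assms(3) by (simp add: irng_def V_def)
  ultimately show thesis
    by (rule that)
qed

section \<open>The action on finite paths and its faithfulness\<close>

locale self_similar_graph_action = self_similar_action E G \<phi>
  for E :: "('v,'e) pre_digraph" and G :: "('v,'g) groupoid" and \<phi> :: "'g \<Rightarrow> ('v,'e) piso" +
  assumes wf: "wf_digraph E"
begin

lemmas chain_append = chain_append[OF wf]
  and chain_prefix = chain_prefix[OF wf]

lemma objs_PIso_unit: "v \<in> objs G \<Longrightarrow> \<phi> (gunit G v) = (v, restrict id (paths_at E v), v)"
  using hom_unit unit_space by (simp add: PIso_def)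

text \<open>A homomorphism is only required to send composable pairs to composable pairs. Composing
  \<open>g\<close> with the units at its two ends, whose images are known, determines the domain and
  codomain of \<open>\<phi> g\<close>.\<close>

lemma phi_eq:
  assumes "g \<in> arrs G"
  shows "\<phi> g = (gcod G g, act \<phi> g, gdom G g)"
proof -
  obtain w f v where eq: "\<phi> g = (w, f, v)"
    by (cases "\<phi> g") auto
  have "gdom (PIso E) (\<phi> g) = gcod (PIso E) (\<phi> (gunit G (gdom G g)))"
    using hom assms gdom_in gunit_in gcod_unit unfolding groupoid_hom_def by metis
  moreover have "gdom (PIso E) (\<phi> (gunit G (gcod G g))) = gcod (PIso E) (\<phi> g)"
    using hom assms gcod_in gunit_in gdom_unit unfolding groupoid_hom_def by metis
  ultimately show ?thesis
    using eq objs_PIso_unit gdom_in[OF assms] gcod_in[OF assms] by (simp add: PIso_def act_def)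
qed

lemma piso_phi:
  assumes "g \<in> arrs G"
  shows "is_piso E (gcod G g, act \<phi> g, gdom G g)"
  using hom assms phi_eq[OF assms] by (auto simp: groupoid_hom_def PIso_def)

lemma act_in_paths_at: "g \<in> arrs G \<Longrightarrow> \<mu> \<in> paths_at E (gdom G g) \<Longrightarrow> act \<phi> g \<mu> \<in> paths_at E (gcod G g)"
  using piso_phi[of g] by (auto simp: is_piso_def bij_betw_def)

lemma plen_act: "g \<in> arrs G \<Longrightarrow> \<mu> \<in> paths_at E (gdom G g) \<Longrightarrow> plen (act \<phi> g \<mu>) = plen \<mu>"
  using piso_phi[of g] by (auto simp: is_piso_def)

lemma act_gmul:
  assumes "g \<in> arrs G" "h \<in> arrs G" "gdom G g = gcod G h" "\<mu> \<in> paths_at E (gdom G h)"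
  shows "act \<phi> (gmul G g h) \<mu> = act \<phi> g (act \<phi> h \<mu>)"
proof -
  have "\<phi> (gmul G g h) = gmul (PIso E) (\<phi> g) (\<phi> h)"
    using hom assms unfolding groupoid_hom_def by blast
  then show ?thesis
    using assms(4) by (simp add: PIso_def act_def[of _ "gmul G g h"] phi_eq assms compose_eq)
qed

lemma act_gunit: "v \<in> objs G \<Longrightarrow> \<mu> \<in> paths_at E v \<Longrightarrow> act \<phi> (gunit G v) \<mu> = \<mu>"
  by (simp add: act_def objs_PIso_unit)

text \<open>Faithfulness of the action. Partial isomorphisms are extensional, so agreement on paths
  is equality of the functions, and \<open>\<phi>\<close> is injective.\<close>

lemma arr_eqI:
  assumes "g \<in> arrs G" "h \<in> arrs G" "gdom G g = gdom G h" "gcod G g = gcod G h"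
    and "\<And>\<mu>. \<mu> \<in> paths_at E (gdom G g) \<Longrightarrow> act \<phi> g \<mu> = act \<phi> h \<mu>"
  shows "g = h"
proof -
  have "act \<phi> g = act \<phi> h"
    using piso_phi[OF assms(1)] piso_phi[OF assms(2)] assms(3,5)
    by (intro extensionalityI[of _ "paths_at E (gdom G g)"]) (auto simp: is_piso_def)
  then show ?thesis
    using inj assms phi_eq by (metis inj_onD)
qed

section \<open>The action and its restrictions on lists of edges\<close>

definition eact :: "'g \<Rightarrow> 'e \<Rightarrow> 'e" where
  "eact g e = hd (snd (act \<phi> g (edge_path E e)))"

abbreviation erestr :: "'g \<Rightarrow> 'e \<Rightarrow> 'g" where
  "erestr \<equiv> restr_edge E G \<phi>"

abbreviation lrestr :: "'g \<Rightarrow> 'e list \<Rightarrow> 'g" where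
  "lrestr \<equiv> foldl erestr"

text \<open>The action on bare edge lists, by recursion along the self-similarity law. It carries no
  range vertex, so identities follow by structural induction; \<open>act_eq_lact\<close> translates
  back to \<open>act\<close>.\<close>

primrec lact :: "'g \<Rightarrow> 'e list \<Rightarrow> 'e list" where
  "lact g [] = []"
| "lact g (e # es) = eact g e # lact (erestr g e) es"

lemma edge_path_in_paths_at: "e \<in> edges_at E v \<Longrightarrow> edge_path E e \<in> paths_at E v"
  by (auto simp: edges_at_def edge_path_def wf_digraph.tail_in_verts[OF wf])

lemma act_edge_path:
  assumes "g \<in> arrs G" "e \<in> edges_at E (gdom G g)"
  shows "act \<phi> g (edge_path E e) = (gcod G g, [eact g e])" "eact g e \<in> edges_at E (gcod G g)"
proof -
  note p = edge_path_in_paths_at[OF assms(2)]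
  obtain es where es: "act \<phi> g (edge_path E e) = (gcod G g, es)" "chain E (gcod G g) es"
    using act_in_paths_at[OF assms(1) p] by (rule paths_atE)
  then have "length es = 1"
    using plen_act[OF assms(1) p] by (simp add: edge_path_def)
  then obtain f where f: "es = [f]"
    by (auto simp: length_Suc_conv)
  then have "eact g e = f"
    using es by (simp add: eact_def)
  then show "act \<phi> g (edge_path E e) = (gcod G g, [eact g e])" "eact g e \<in> edges_at E (gcod G g)"
    using es f by (auto simp: edges_at_def)
qed

text \<open>Both candidates describe what \<open>g\<close> does behind the edge \<open>e\<close>.
  Cancelling the image of \<open>e\<close> shows that they act equally, and faithfulness identifies
  them.\<close>

lemma is_restriction_unique:
  assumes g: "g \<in> arrs G" "e \<in> edges_at E (gdom G g)"
    and h: "is_restriction E G \<phi> g e h" and k: "is_restriction E G \<phi> g e k"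
  shows "h = k"
proof (rule arr_eqI)
  fix \<mu> assume "\<mu> \<in> paths_at E (gdom G h)"
  then have \<mu>: "\<mu> \<in> paths_at E (gdom G h)" "\<mu> \<in> paths_at E (gdom G k)" "\<mu> \<in> paths_at E (tail E e)"
    using h k by (auto simp: is_restriction_def)
  have arrs: "h \<in> arrs G" "k \<in> arrs G" "gcod G h = gcod G k"
    using h k by (auto simp: is_restriction_def)
  have "pcat (act \<phi> g (edge_path E e)) (act \<phi> h \<mu>) = pcat (act \<phi> g (edge_path E e)) (act \<phi> k \<mu>)"
    using h k \<mu> unfolding is_restriction_def by metis
  moreover obtain es where "act \<phi> h \<mu> = (gcod G h, es)"
    using act_in_paths_at[OF arrs(1) \<mu>(1)] by (rule paths_atE)
  moreover obtain fs where "act \<phi> k \<mu> = (gcod G k, fs)"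
    using act_in_paths_at[OF arrs(2) \<mu>(2)] by (rule paths_atE)
  ultimately show "act \<phi> h \<mu> = act \<phi> k \<mu>"
    using arrs by (simp add: pcat_def)
qed (use h k in \<open>auto simp: is_restriction_def\<close>)

lemma is_restriction_erestr:
  assumes "g \<in> arrs G" "e \<in> edges_at E (gdom G g)"
  shows "is_restriction E G \<phi> g e (erestr g e)"
  unfolding restr_edge_def
  using self_similar[OF assms] is_restriction_unique[OF assms] by (rule theI'[OF ex_ex1I])

lemma
  assumes "g \<in> arrs G" "e \<in> edges_at E (gdom G g)"
  shows erestr_in: "erestr g e \<in> arrs G"
    and gdom_erestr: "gdom G (erestr g e) = tail E e"
    and gcod_erestr: "gcod G (erestr g e) = tail E (eact g e)"
    and act_Cons: "chain E (tail E e) es \<Longrightarrow>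
      act \<phi> g (gdom G g, e # es) = (gcod G g, eact g e # snd (act \<phi> (erestr g e) (tail E e, es)))"
proof -
  note r = is_restriction_erestr[OF assms] act_edge_path[OF assms]
  show "erestr g e \<in> arrs G" "gdom G (erestr g e) = tail E e"
    "gcod G (erestr g e) = tail E (eact g e)"
    using r by (auto simp: is_restriction_def)
  assume "chain E (tail E e) es"
  then have "act \<phi> g (pcat (edge_path E e) (tail E e, es))
      = pcat (gcod G g, [eact g e]) (act \<phi> (erestr g e) (tail E e, es))"
    using r by (auto simp: is_restriction_def)
  then show "act \<phi> g (gdom G g, e # es) = (gcod G g, eact g e # snd (act \<phi> (erestr g e) (tail E e, es)))"
    using assms(2) by (simp add: edge_path_def edges_at_def pcat_def rng_def)
qed

lemma act_eq_lact:
  assumes "g \<in> arrs G" "chain E (gdom G g) es"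
  shows "act \<phi> g (gdom G g, es) = (gcod G g, lact g es)"
  using assms
proof (induction es arbitrary: g)
  case Nil
  obtain es where "act \<phi> g (gdom G g, []) = (gcod G g, es)"
    using act_in_paths_at[OF Nil(1), of "(gdom G g, [])"] Nil by (auto elim!: paths_atE)
  then show ?case
    using plen_act[OF Nil(1), of "(gdom G g, [])"] Nil by simp
next
  case (Cons e es)
  then have "e \<in> edges_at E (gdom G g)" "chain E (tail E e) es"
    by (auto simp: edges_at_def)
  then show ?case
    using Cons.IH[of "erestr g e"] Cons.prems(1) by (simp add: act_Cons erestr_in gdom_erestr)
qed

lemma lrestr_props:
  assumes "g \<in> arrs G" "chain E (gdom G g) es"
  shows "lrestr g es \<in> arrs G \<and> gdom G (lrestr g es) = src E (gdom G g, es)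
    \<and> chain E (gcod G g) (lact g es) \<and> gcod G (lrestr g es) = src E (gcod G g, lact g es)"
  using assms
proof (induction es arbitrary: g)
  case Nil
  then show ?case
    using gcod_in unit_space by auto
next
  case (Cons e es)
  then have "e \<in> edges_at E (gdom G g)" "chain E (tail E e) es"
    by (auto simp: edges_at_def)
  then show ?case
    using Cons.IH[of "erestr g e"] Cons.prems(1) act_edge_path(2)[of g e]
    by (auto simp: erestr_in gdom_erestr gcod_erestr edges_at_def)
qed

lemma length_lact [simp]: "length (lact g es) = length es"
  by (induction es arbitrary: g) auto

lemma lact_append: "lact g (es @ fs) = lact g es @ lact (lrestr g es) fs"
  by (induction es arbitrary: g) auto

lemma lact_gmul:
  assumes "g \<in> arrs G" "h \<in> arrs G" "gdom G g = gcod G h" "chain E (gdom G h) es"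
  shows "lact (gmul G g h) es = lact g (lact h es)"
proof -
  have "chain E (gdom G g) (lact h es)"
    using lrestr_props assms by simp
  then show ?thesis
    using act_gmul[of g h "(gdom G h, es)"] act_eq_lact[of h es] act_eq_lact[of g "lact h es"]
      act_eq_lact[of "gmul G g h" es] assms gmul_in gdom_mul gcod_mul
    by simp
qed

lemma lact_gunit: "v \<in> objs G \<Longrightarrow> chain E v es \<Longrightarrow> lact (gunit G v) es = es"
  using act_gunit[of v "(v, es)"] act_eq_lact[of "gunit G v" es] gunit_in gdom_unit by simp

lemma arr_eqI_lact:
  assumes "g \<in> arrs G" "h \<in> arrs G" "gdom G g = gdom G h" "gcod G g = gcod G h"
    and "\<And>es. chain E (gdom G g) es \<Longrightarrow> lact g es = lact h es"
  shows "g = h"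
  using assms(1-4)
proof (rule arr_eqI)
  fix \<mu> assume "\<mu> \<in> paths_at E (gdom G g)"
  then show "act \<phi> g \<mu> = act \<phi> h \<mu>"
    using assms act_eq_lact by (auto elim!: paths_atE) metis
qed

text \<open>Apply the product, and then \<open>h\<close> followed by \<open>g\<close>, to a path
  beginning with \<open>e\<close>. Behind the first edge the two results are the actions of the two
  sides, so faithfulness applies.\<close>

lemma erestr_gmul:
  assumes "g \<in> arrs G" "h \<in> arrs G" "gdom G g = gcod G h" "e \<in> edges_at E (gdom G h)"
  shows "erestr (gmul G g h) e = gmul G (erestr g (eact h e)) (erestr h e)"
proof -
  note gh = gmul_in[OF assms(1-3)] gdom_mul[OF assms(1-3)] gcod_mul[OF assms(1-3)]
  have e: "eact h e \<in> edges_at E (gdom G g)" "e \<in> edges_at E (gdom G (gmul G g h))"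
    using act_edge_path assms gh by auto
  have comp: "gdom G (erestr g (eact h e)) = gcod G (erestr h e)"
    using e assms by (simp add: gdom_erestr gcod_erestr)
  have ch: "chain E (gdom G h) (e # es)" if "chain E (tail E e) es" for es
    using that assms(4) by (auto simp: edges_at_def)
  have *: "eact (gmul G g h) e # lact (erestr (gmul G g h) e) es
      = eact g (eact h e) # lact (gmul G (erestr g (eact h e)) (erestr h e)) es"
    if "chain E (tail E e) es" for es
    using lact_gmul[OF assms(1-3) ch[OF that]] assms e comp that
    by (simp add: lact_gmul erestr_in gdom_erestr)
  \<comment> \<open>The instance for the empty list says that both ways send \<open>e\<close> to the
    same edge, which makes the codomains agree.\<close>
  show ?thesis
    by (rule arr_eqI_lact)
      (use *[of "[]"] * wf assms gh e comp in \<open>auto simp: erestr_in gdom_erestr gcod_erestr gmul_in gdom_mul gcod_mul edges_at_def wf_digraph.tail_in_verts\<close>)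
qed

lemma lrestr_gmul:
  assumes "g \<in> arrs G" "h \<in> arrs G" "gdom G g = gcod G h" "chain E (gdom G h) es"
  shows "lrestr (gmul G g h) es = gmul G (lrestr g (lact h es)) (lrestr h es)"
  using assms
proof (induction es arbitrary: g h)
  case (Cons e es)
  then have e: "e \<in> edges_at E (gdom G h)" "chain E (tail E e) es"
    by (auto simp: edges_at_def)
  then have "eact h e \<in> edges_at E (gdom G g)"
    using Cons.prems by (simp add: act_edge_path)
  then show ?case
    using Cons e by (simp add: erestr_gmul erestr_in gdom_erestr gcod_erestr)
qed simp

text \<open>A unit fixes every path beginning with \<open>e\<close>, so its restriction fixes every
  path at the source of \<open>e\<close> and is a unit by faithfulness.\<close>

lemma erestr_gunit:
  assumes "v \<in> objs G" "e \<in> edges_at E v"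
  shows "erestr (gunit G v) e = gunit G (tail E e)"
proof -
  note u = gunit_in[OF assms(1)] gdom_unit[OF assms(1)]
  have tv: "tail E e \<in> objs G"
    using assms(2) unit_space wf by (auto simp: edges_at_def wf_digraph.tail_in_verts)
  have *: "eact (gunit G v) e = e \<and> lact (erestr (gunit G v) e) es = es" if "chain E (tail E e) es" for es
    using lact_gunit[OF assms(1), of "e # es"] assms(2) that by (simp add: edges_at_def)
  show ?thesis
    by (rule arr_eqI_lact)
      (use *[of "[]"] * u assms tv unit_space in
        \<open>auto simp: erestr_in gdom_erestr gcod_erestr gunit_in gdom_unit gcod_unit lact_gunit\<close>)
qed

lemma lrestr_gunit:
  assumes "chain E v es"
  shows "lrestr (gunit G v) es = gunit G (src E (v, es))"
  using assms chain_in_verts[OF wf assms]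
proof (induction es arbitrary: v)
  case (Cons e es)
  then have "e \<in> edges_at E v" "chain E (tail E e) es" "v \<in> objs G"
    by (auto simp: edges_at_def unit_space)
  then show ?case
    using Cons.IH[of "tail E e"] erestr_gunit[of v e] chain_in_verts[OF wf] by simp
qed simp

section \<open>Cancellation and quotients of parallel arrows\<close>

lemma gmul_left_cancel:
  assumes "a \<in> arrs G" "b \<in> arrs G" "c \<in> arrs G" "gdom G a = gcod G b" "gdom G a = gcod G c"
    and "gmul G a b = gmul G a c"
  shows "b = c"
proof -
  have "gmul G (ginv G a) (gmul G a d) = d" if "d \<in> arrs G" "gdom G a = gcod G d" for d
    using that assms(1) by (simp flip: gmul_assoc add: ginv_in gdom_inv gmul_inv_left gmul_unit_left)
  then show ?thesis
    using assms by metis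
qed

text \<open>Two arrows that agree along a path are compared through the quotient \<open>h\<^sup>-\<^sup>1g\<close>.\<close>

lemma
  assumes "g \<in> arrs G" "h \<in> arrs G" "gdom G g = gdom G h" "gcod G g = gcod G h"
  shows quotient_in: "gmul G (ginv G h) g \<in> arrs G"
    and gdom_quotient: "gdom G (gmul G (ginv G h) g) = gdom G g"
    and gcod_quotient: "gcod G (gmul G (ginv G h) g) = gdom G g"
    and lact_quotient:
      "chain E (gdom G g) es \<Longrightarrow> lact g es = lact h es \<Longrightarrow> lact (gmul G (ginv G h) g) es = es"
    and lrestr_quotient_eq_unit_iff:
      "chain E (gdom G g) es \<Longrightarrow> lact g es = lact h es \<Longrightarrow>
        lrestr (gmul G (ginv G h) g) es = gunit G (src E (gdom G g, es)) \<longleftrightarrow> lrestr g es = lrestr h es"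
proof -
  have inv: "ginv G h \<in> arrs G" "gdom G (ginv G h) = gcod G g" "gdom G (ginv G h) = gcod G h"
    using assms by (auto simp: ginv_in gdom_inv)
  show "gmul G (ginv G h) g \<in> arrs G" "gdom G (gmul G (ginv G h) g) = gdom G g"
    "gcod G (gmul G (ginv G h) g) = gdom G g"
    using assms inv by (auto simp: gmul_in gdom_mul gcod_mul gcod_inv)
  assume ch: "chain E (gdom G g) es" and eq: "lact g es = lact h es"
  have ch': "chain E (gdom G h) es" "chain E (gdom G (ginv G h)) (lact g es)"
    "chain E (gdom G (ginv G h)) (lact h es)"
    using ch lrestr_props[OF assms(1) ch] assms eq inv by auto
  \<comment> \<open>On \<open>es\<close> the arrow \<open>g\<close> may be replaced by
    \<open>h\<close>, which turns the quotient into a unit.\<close>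
  have "lact (gmul G (ginv G h) g) es = lact (gmul G (ginv G h) h) es"
    using ch ch' eq inv assms by (simp add: lact_gmul)
  then show "lact (gmul G (ginv G h) g) es = es"
    using assms ch' by (simp add: gmul_inv_left lact_gunit gdom_in)
  \<comment> \<open>The restrictions to \<open>es\<close> of the quotient and of the unit
    \<open>gmul G (ginv G h) h\<close> have the same left factor \<open>a\<close>; cancelling it
    leaves the restrictions of \<open>g\<close> and \<open>h\<close>.\<close>
  define a where "a = lrestr (ginv G h) (lact h es)"
  have a: "a \<in> arrs G" "gdom G a = src E (gcod G h, lact h es)"
    using lrestr_props[OF inv(1) ch'(3)] inv by (auto simp: a_def)
  have "lrestr (gmul G (ginv G h) g) es = gmul G a (lrestr g es)"
    using ch eq inv assms by (simp add: lrestr_gmul a_def)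
  moreover have "gunit G (src E (gdom G h, es)) = gmul G a (lrestr h es)"
    using ch' inv assms lrestr_gmul[of "ginv G h" h es] by (simp add: gmul_inv_left lrestr_gunit a_def)
  moreover have "lrestr g es \<in> arrs G" "lrestr h es \<in> arrs G"
    "gdom G a = gcod G (lrestr g es)" "gdom G a = gcod G (lrestr h es)"
    using lrestr_props[OF assms(1) ch] lrestr_props[OF assms(2) ch'(1)] a eq assms by auto
  ultimately show "lrestr (gmul G (ginv G h) g) es = gunit G (src E (gdom G g, es))
      \<longleftrightarrow> lrestr g es = lrestr h es"
    using gmul_left_cancel[OF a(1)] assms by metis
qed

section \<open>The action on infinite paths\<close>

lemma iact_nth:
  assumes "g \<in> arrs G" "x \<in> ipaths E" "irng E x = gdom G g"
  shows "iact E \<phi> g x i = eact (lrestr g (prefix i x)) (x i)"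
proof -
  have "act \<phi> g (gdom G g, prefix (Suc i) x) = (gcod G g, lact g (prefix (Suc i) x))"
    using act_eq_lact[OF assms(1)] chain_prefix[OF assms(2)] assms(3) by metis
  then show ?thesis
    using assms(3) by (simp add: iact_def lact_append)
qed

lemma prefix_iact:
  assumes "g \<in> arrs G" "x \<in> ipaths E" "irng E x = gdom G g"
  shows "prefix n (iact E \<phi> g x) = lact g (prefix n x)"
  by (induction n) (auto simp: lact_append iact_nth[OF assms])

lemma lrestr_prefix:
  assumes "g \<in> arrs G" "x \<in> ipaths E" "irng E x = gdom G g"
  shows "lrestr g (prefix n x) \<in> arrs G \<and> gdom G (lrestr g (prefix n x)) = irng E (suffix n x)"
  using lrestr_props[OF assms(1), of "prefix n x"] chain_prefix[OF assms(2), of n] src_prefix[OF assms(2), of n]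
    assms(3) by simp

lemma lrestr_prefix_add:
  "lrestr g (prefix (m + n) x) = lrestr (lrestr g (prefix m x)) (prefix n (suffix m x))"
  unfolding prefix_add by simp

text \<open>The self-similarity law for infinite paths. By \<open>iact_nth\<close>, edge
  \<open>i\<close> on either side is the image of \<open>x (n + i)\<close> under the restriction of
  \<open>g\<close> to the first \<open>n + i\<close> edges.\<close>

lemma suffix_iact:
  assumes "g \<in> arrs G" "x \<in> ipaths E" "irng E x = gdom G g"
  shows "suffix n (iact E \<phi> g x) = iact E \<phi> (lrestr g (prefix n x)) (suffix n x)"
proof
  fix i
  show "suffix n (iact E \<phi> g x) i = iact E \<phi> (lrestr g (prefix n x)) (suffix n x) i"
    using lrestr_prefix[OF assms, of n] ipaths_suffix[OF assms(2)]
    by (simp add: iact_nth assms lrestr_prefix_add[of g x n i, symmetric] del: subsequence_shift)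
qed

lemma irng_in_objs: "x \<in> ipaths E \<Longrightarrow> irng E x \<in> objs G"
  using wf by (simp add: unit_space irng_def ipaths_def wf_digraph.head_in_verts)

lemma eact_in_edges_at:
  assumes "g \<in> arrs G" "x \<in> ipaths E" "irng E x = gdom G g"
  shows "eact g (x 0) \<in> edges_at E (gcod G g) \<and> x 0 \<in> edges_at E (gdom G g)"
proof -
  have "x 0 \<in> edges_at E (gdom G g)"
    using assms by (simp add: edges_at_def irng_def ipaths_def)
  then show ?thesis
    using act_edge_path assms by simp
qed

lemma
  assumes "g \<in> arrs G" "x \<in> ipaths E" "irng E x = gdom G g"
  shows irng_iact: "irng E (iact E \<phi> g x) = gcod G g"
    and iact_in_ipaths: "iact E \<phi> g x \<in> ipaths E"
proof -
  \<comment> \<open>Proved for all arrows and paths, since it is used below for the restriction of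
    \<open>g\<close> to a prefix.\<close>
  have *: "irng E (iact E \<phi> g x) = gcod G g"
    if "g \<in> arrs G" "x \<in> ipaths E" "irng E x = gdom G g" for g x
    using eact_in_edges_at[OF that] by (simp add: irng_def iact_nth[OF that] edges_at_def)
  then show "irng E (iact E \<phi> g x) = gcod G g"
    using assms by blast
  show "iact E \<phi> g x \<in> ipaths E"
    unfolding ipaths_def
  proof (intro CollectI allI)
    fix i
    \<comment> \<open>Passing to the restriction \<open>h\<close> moves position \<open>i\<close> to
      position \<open>0\<close>. There the source of the image edge is the codomain of the next
      restriction, which is the range of what follows.\<close>
    define h z where "h = lrestr g (prefix i x)" and "z = suffix i x"
    have h: "h \<in> arrs G" "z \<in> ipaths E" "irng E z = gdom G h"
      using lrestr_prefix[OF assms, of i] ipaths_suffix[OF assms(2)] by (auto simp: h_def z_def)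
    have i: "iact E \<phi> g x i = eact h (z 0)"
      using iact_nth[OF assms] by (simp add: h_def z_def)
    have h1: "lrestr g (prefix (Suc i) x) = erestr h (z 0)"
      by (simp add: h_def z_def)
    have "head E (iact E \<phi> g x (Suc i)) = irng E (iact E \<phi> (erestr h (z 0)) (suffix (Suc i) x))"
      using suffix_iact[OF assms, of "Suc i"] h1 by (simp add: irng_def fun_eq_iff del: subseq_to_Suc)
        (metis add.right_neutral)
    also have "\<dots> = gcod G (erestr h (z 0))"
      using *[of "lrestr g (prefix (Suc i) x)" "suffix (Suc i) x"] lrestr_prefix[OF assms, of "Suc i"]
        ipaths_suffix[OF assms(2)] h1 by metis
    finally show "iact E \<phi> g x i \<in> arcs E \<and> tail E (iact E \<phi> g x i) = head E (iact E \<phi> g x (Suc i))"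
      using eact_in_edges_at[OF h] h i by (simp add: gcod_erestr edges_at_def)
  qed
qed

lemma iact_gunit:
  assumes "x \<in> ipaths E"
  shows "iact E \<phi> (gunit G (irng E x)) x = x"
proof (rule word_eqI_prefix)
  fix n
  note v = irng_in_objs[OF assms]
  show "prefix n (iact E \<phi> (gunit G (irng E x)) x) = prefix n x"
    using assms v chain_prefix[OF assms] by (simp add: prefix_iact gunit_in gdom_unit lact_gunit)
qed

section \<open>Tuples and their equivalence classes\<close>

lemma tuples_iff:
  "(x, m, g, n, y) \<in> tuples E G \<phi> \<longleftrightarrow> x \<in> ipaths E \<and> g \<in> arrs G \<and> y \<in> ipaths E \<and>
     irng E (suffix n y) = gdom G g \<and> suffix m x = iact E \<phi> g (suffix n y)"
  by (auto simp: tuples_def)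

text \<open>The position \<open>l\<close> is written both as \<open>n + i\<close> and as
  \<open>q + j\<close>, and the integer equation of degrees becomes one of natural numbers, so that
  no subtraction remains.\<close>

lemma tuple_rel_iff:
  "((x, m, g, n, y), (w, p, h, q, z)) \<in> tuple_rel E G \<phi> \<longleftrightarrow>
     (x, m, g, n, y) \<in> tuples E G \<phi> \<and> (w, p, h, q, z) \<in> tuples E G \<phi> \<and>
     x = w \<and> y = z \<and> m + q = n + p \<and>
     (\<exists>i j. n + i = q + j \<and> lrestr g (prefix i (suffix n y)) = lrestr h (prefix j (suffix q y)))"
proof -
  have "(\<exists>l\<ge>max n q. restr E G \<phi> g (seg E y n l) = restr E G \<phi> h (seg E y q l)) \<longleftrightarrow>
     (\<exists>i j. n + i = q + j \<and> lrestr g (prefix i (suffix n y)) = lrestr h (prefix j (suffix q y)))"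
    (is "?L \<longleftrightarrow> ?R")
  proof
    assume ?L
    then obtain l where "l \<ge> max n q" "restr E G \<phi> g (seg E y n l) = restr E G \<phi> h (seg E y q l)"
      by auto
    then show ?R
      by (intro exI[of _ "l - n"] exI[of _ "l - q"]) (simp add: restr_def seg_def)
  next
    assume ?R
    then obtain i j where ij: "n + i = q + j"
      "lrestr g (prefix i (suffix n y)) = lrestr h (prefix j (suffix q y))"
      by auto
    then show ?L
      by (intro exI[of _ "n + i"]) (auto simp: restr_def seg_def)
  qed
  then show ?thesis
    by (auto simp: tuple_rel_def)
qed

text \<open>Since \<open>n + i = q + j\<close>, both sides are restricted further along the same
  \<open>d\<close> edges of \<open>y\<close>.\<close>

lemma lrestr_eq_extend:
  assumes "n + i = q + j" "lrestr g (prefix i (suffix n y)) = lrestr h (prefix j (suffix q y))"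
  shows "lrestr g (prefix (i + d) (suffix n y)) = lrestr h (prefix (j + d) (suffix q y))"
  using assms unfolding lrestr_prefix_add suffix_suffix by (simp del: subsequence_shift)

lemma equiv_tuple_rel: "equiv (tuples E G \<phi>) (tuple_rel E G \<phi>)"
proof (rule equivI)
  show "tuple_rel E G \<phi> \<subseteq> tuples E G \<phi> \<times> tuples E G \<phi>"
    by (auto simp: tuple_rel_def)
  show "refl_on (tuples E G \<phi>) (tuple_rel E G \<phi>)"
  proof (rule refl_onI)
    fix t assume "t \<in> tuples E G \<phi>"
    then show "(t, t) \<in> tuple_rel E G \<phi>"
      by (cases t) (auto simp: tuple_rel_iff)
  qed
  show "sym (tuple_rel E G \<phi>)"
    by (rule symI) (auto simp: tuple_rel_iff, metis)
  show "trans (tuple_rel E G \<phi>)"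
  proof (rule transI)
    fix t u v assume tu: "(t, u) \<in> tuple_rel E G \<phi>" and uv: "(u, v) \<in> tuple_rel E G \<phi>"
    obtain x m g n y w p h q z w' p' h' q' z'
      where eqs: "t = (x, m, g, n, y)" "u = (w, p, h, q, z)" "v = (w', p', h', q', z')"
      by (metis prod_cases5)
    obtain i j where ij: "n + i = q + j"
      "lrestr g (prefix i (suffix n y)) = lrestr h (prefix j (suffix q y))"
      using tu unfolding eqs tuple_rel_iff by auto
    obtain i' j' where ij': "q + i' = q' + j'"
      "lrestr h (prefix i' (suffix q y)) = lrestr h' (prefix j' (suffix q' y))"
      using tu uv unfolding eqs tuple_rel_iff by auto
    \<comment> \<open>Both agreements are pushed to the common position
      \<open>n + i + i' = q + j + i' = q' + j' + j\<close>.\<close>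
    have "lrestr g (prefix (i + i') (suffix n y)) = lrestr h' (prefix (j' + j) (suffix q' y))"
      using lrestr_eq_extend[OF ij, of i'] lrestr_eq_extend[OF ij', of j]
      by (simp only: add.commute[of i' j])
    moreover have "n + (i + i') = q' + (j' + j)"
      using ij(1) ij'(1) by simp
    moreover have "t \<in> tuples E G \<phi>" "v \<in> tuples E G \<phi>" "x = w'" "y = z'" "m + q' = n + p'"
      using tu uv unfolding eqs tuple_rel_iff by (elim conjE; simp del: subsequence_shift)+
    ultimately show "(t, v) \<in> tuple_rel E G \<phi>"
      unfolding eqs tuple_rel_iff by blast
  qed
qed

lemma cls_eq_iff:
  "t \<in> tuples E G \<phi> \<Longrightarrow> u \<in> tuples E G \<phi> \<Longrightarrow> cls E G \<phi> t = cls E G \<phi> u \<longleftrightarrow> (t, u) \<in> tuple_rel E G \<phi>"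
  unfolding cls_def by (rule eq_equiv_class_iff[OF equiv_tuple_rel])

text \<open>Reading \<open>k\<close> more edges changes only the representative: restricted up to
  position \<open>n + k\<close>, both tuples give the same element. This is how two arrows of equal
  degree are brought to the same pair of exponents.\<close>

lemma
  assumes "(x, m, g, n, y) \<in> tuples E G \<phi>"
  shows tuples_shift: "(x, m + k, lrestr g (prefix k (suffix n y)), n + k, y) \<in> tuples E G \<phi>" (is "?t \<in> _")
    and cls_shift: "cls E G \<phi> (x, m + k, lrestr g (prefix k (suffix n y)), n + k, y) = cls E G \<phi> (x, m, g, n, y)"
proof -
  have g: "g \<in> arrs G" "suffix n y \<in> ipaths E" "irng E (suffix n y) = gdom G g"
    using assms ipaths_suffix by (auto simp: tuples_iff)
  have "suffix (m + k) x = suffix k (suffix m x)"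
    by simp
  also have "\<dots> = suffix k (iact E \<phi> g (suffix n y))"
    using assms by (simp add: tuples_iff)
  finally show t: "?t \<in> tuples E G \<phi>"
    using assms lrestr_prefix[OF g] suffix_iact[OF g] by (simp add: tuples_iff del: subsequence_shift)
  show "cls E G \<phi> ?t = cls E G \<phi> (x, m, g, n, y)"
    unfolding cls_eq_iff[OF t assms] tuple_rel_iff
    using t assms by (intro conjI exI[of _ 0] exI[of _ k]) auto
qed

section \<open>Basic open sets and neighbourhoods of an arrow\<close>

lemma Zset_tuple_in_tuples:
  assumes "chain E v es" "chain E w fs" "g \<in> arrs G" "src E (v, es) = gcod G g" "src E (w, fs) = gdom G g"
    and "y \<in> ipaths E" "irng E y = gdom G g"
  shows "(es \<frown> iact E \<phi> g y, length es, g, length fs, fs \<frown> y) \<in> tuples E G \<phi>"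
  using assms conc_in_ipaths[of E v es "iact E \<phi> g y"] conc_in_ipaths[of E w fs y]
  by (simp add: tuples_iff iact_in_ipaths irng_iact)

lemma openin_Zset:
  assumes "chain E v es" "chain E w fs" "g \<in> arrs G" "src E (v, es) = gcod G g" "src E (w, fs) = gdom G g"
  shows "openin (ss_topology E G \<phi>) (Zset E G \<phi> (v, es) g (w, fs))"
  unfolding ss_topology_def
  by (rule topology_generated_by_Basis)
    (use assms in \<open>intro CollectI exI[of _ "(v, es)"] exI[of _ g] exI[of _ "(w, fs)"]; simp\<close>)

lemma topspace_ss_topologyE:
  assumes "a \<in> topspace (ss_topology E G \<phi>)"
  obtains x m g n y where "(x, m, g, n, y) \<in> tuples E G \<phi>" "a = cls E G \<phi> (x, m, g, n, y)"
proof -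
  obtain v es g w fs y where "chain E v es" "chain E w fs" "g \<in> arrs G" "src E (v, es) = gcod G g"
    "src E (w, fs) = gdom G g" "y \<in> ipaths E" "irng E y = gdom G g"
    "a = cls E G \<phi> (es \<frown> iact E \<phi> g y, length es, g, length fs, fs \<frown> y)"
    using assms unfolding ss_topology_def topology_generated_by_topspace by (auto simp: Zset_def)
  then show thesis
    using that Zset_tuple_in_tuples by metis
qed

text \<open>The basic open set read off from the representative advanced by \<open>k\<close> edges;
  larger \<open>k\<close> prescribes longer initial segments of range and source.\<close>

definition nbhd :: "('e,'g) tup \<Rightarrow> nat \<Rightarrow> ('e,'g) tup set set" where
  "nbhd = (\<lambda>(x, m, g, n, y) k. Zset E G \<phi> (irng E x, prefix (m + k) x)
     (lrestr g (prefix k (suffix n y))) (irng E y, prefix (n + k) y))"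

text \<open>By \<open>cls_shift\<close> the arrow equals the class of its advanced representative,
  and the remaining tail of \<open>y\<close> is the parameter showing membership. The last claim
  records what a member shares with that representative.\<close>

lemma
  assumes "(x, m, g, n, y) \<in> tuples E G \<phi>"
  shows openin_nbhd: "openin (ss_topology E G \<phi>) (nbhd (x, m, g, n, y) k)" (is ?thesis1)
    and cls_in_nbhd: "cls E G \<phi> (x, m, g, n, y) \<in> nbhd (x, m, g, n, y) k" (is ?thesis2)
    and nbhdE: "a \<in> nbhd (x, m, g, n, y) k \<Longrightarrow> \<exists>x' y'.
      (x', m + k, lrestr g (prefix k (suffix n y)), n + k, y') \<in> tuples E G \<phi> \<and>
      a = cls E G \<phi> (x', m + k, lrestr g (prefix k (suffix n y)), n + k, y') \<and>
      prefix (m + k) x' = prefix (m + k) x \<and> prefix (n + k) y' = prefix (n + k) y" (is "_ \<Longrightarrow> ?thesis3")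
proof -
  define h where "h = lrestr g (prefix k (suffix n y))"
  have t: "(x, m + k, h, n + k, y) \<in> tuples E G \<phi>"
    using tuples_shift[OF assms] by (simp add: h_def)
  then have h: "x \<in> ipaths E" "y \<in> ipaths E" "h \<in> arrs G" "irng E (suffix (n + k) y) = gdom G h"
    "suffix (m + k) x = iact E \<phi> h (suffix (n + k) y)"
    by (auto simp: tuples_iff)
  have ch: "chain E (irng E x) (prefix (m + k) x)" "chain E (irng E y) (prefix (n + k) y)"
    "src E (irng E x, prefix (m + k) x) = gcod G h" "src E (irng E y, prefix (n + k) y) = gdom G h"
    using h ipaths_suffix[OF h(2)] by (auto simp: chain_prefix src_prefix irng_iact)
  show ?thesis1
    using openin_Zset[OF ch(1,2) h(3) ch(3,4)] by (simp add: nbhd_def h_def)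
  have "cls E G \<phi> (x, m + k, h, n + k, y) \<in> nbhd (x, m, g, n, y) k"
    unfolding nbhd_def Zset_def prod.case h_def[symmetric]
    using h ch ipaths_suffix[OF h(2)] by (auto intro!: exI[of _ "suffix (n + k) y"] simp flip: h(5))
  then show ?thesis2
    using cls_shift[OF assms] by (simp add: h_def)
  assume "a \<in> nbhd (x, m, g, n, y) k"
  then obtain z where z: "z \<in> ipaths E" "irng E z = gdom G h"
    "a = cls E G \<phi> (prefix (m + k) x \<frown> iact E \<phi> h z, m + k, h, n + k, prefix (n + k) y \<frown> z)"
    unfolding nbhd_def Zset_def prod.case h_def[symmetric] using ch(4) by auto
  then show ?thesis3
    using Zset_tuple_in_tuples[OF ch(1,2) h(3) ch(3,4) z(1,2)] unfolding h_def[symmetric]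
    by (intro exI[of _ "prefix (m + k) x \<frown> iact E \<phi> h z"] exI[of _ "prefix (n + k) y \<frown> z"]) simp
qed

section \<open>Condition (4) implies the Hausdorff property\<close>

lemma restr_Pair [simp]: "restr E G \<phi> g (v, es) = lrestr g es"
  by (simp add: restr_def)

lemma strongly_fixed_iff:
  assumes "g \<in> arrs G" "gdom G g = v" "gcod G g = v" "chain E v es"
  shows "strongly_fixed E G \<phi> g (v, es) \<longleftrightarrow> lact g es = es \<and> lrestr g es = gunit G (src E (v, es))"
  using assms act_eq_lact[of g es] by (auto simp: strongly_fixed_def)

text \<open>Condition (4) as a named proposition, hypothesis of one implication and conclusion of
  the other.\<close>

definition locally_unfixed :: bool where
  "locally_unfixed \<longleftrightarrow> (\<forall>g\<in>arrs G. \<forall>y\<in>ipaths E.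
     irng E y = gdom G g \<and> iact E \<phi> g y = y \<and>
     (\<forall>n. restr E G \<phi> g (seg E y 0 n) \<noteq> gunit G (src E (seg E y 0 n))) \<longrightarrow>
     (\<exists>\<mu>\<in>fpaths E. y \<in> cylinder E \<mu> \<and> \<not> (\<exists>\<nu>\<in>extensions E \<mu>. strongly_fixed E G \<phi> g \<nu>)))"

text \<open>Condition (4) is applied to the quotient \<open>q\<close> of \<open>g\<close> by
  \<open>h\<close> and to the tail \<open>y'\<close> of \<open>y\<close>; the length of the path
  \<mu> it returns is the required \<open>k\<close>.\<close>

lemma separate_parallel:
  assumes locally_unfixed
    and t: "(x, m, g, n, y) \<in> tuples E G \<phi>" and u: "(x, m, h, n, y) \<in> tuples E G \<phi>"
    and ne: "cls E G \<phi> (x, m, g, n, y) \<noteq> cls E G \<phi> (x, m, h, n, y)"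
  obtains k where "disjnt (nbhd (x, m, g, n, y) k) (nbhd (x, m, h, n, y) k)"
proof -
  define y' where "y' = suffix n y"
  have g: "g \<in> arrs G" "y' \<in> ipaths E" "irng E y' = gdom G g" "suffix m x = iact E \<phi> g y'"
    and h: "h \<in> arrs G" "y' \<in> ipaths E" "irng E y' = gdom G h" "suffix m x = iact E \<phi> h y'"
    using t u by (auto simp: tuples_iff y'_def ipaths_suffix)
  have gh: "gdom G g = gdom G h" "gcod G g = gcod G h"
    using g h irng_iact by metis+
  note quot = g(1) h(1) gh
  define q where "q = gmul G (ginv G h) g"
  have q: "q \<in> arrs G" "gdom G q = gdom G g" "gcod G q = gdom G g"
    using quotient_in[OF quot] gdom_quotient[OF quot] gcod_quotient[OF quot] by (auto simp: q_def)
  have chy: "chain E (gdom G g) (prefix i y')" for i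
    using chain_prefix[OF g(2)] g(3) by metis
  have eq: "lact g (prefix i y') = lact h (prefix i y')" for i
    using g h prefix_iact by metis
  have "iact E \<phi> q y' = y'"
    using lact_quotient[OF quot chy eq] q g(2,3)
    by (intro word_eqI_prefix) (simp add: prefix_iact q_def)
  \<comment> \<open>A unit here would make \<open>g\<close> and \<open>h\<close> agree along a
    prefix of \<open>y'\<close>, and the two classes would coincide.\<close>
  moreover have "lrestr q (prefix i y') \<noteq> gunit G (src E (gdom G g, prefix i y'))" for i
  proof
    assume "lrestr q (prefix i y') = gunit G (src E (gdom G g, prefix i y'))"
    then have "lrestr g (prefix i y') = lrestr h (prefix i y')"
      using lrestr_quotient_eq_unit_iff[OF quot chy eq] by (simp add: q_def)
    then show False
      using ne t u unfolding cls_eq_iff[OF t u] tuple_rel_iff y'_def by (metis add.commute)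
  qed
  ultimately obtain \<mu> where \<mu>: "y' \<in> cylinder E \<mu>" "\<forall>\<nu>\<in>extensions E \<mu>. \<not> strongly_fixed E G \<phi> q \<nu>"
    using \<open>locally_unfixed\<close> q g unfolding locally_unfixed_def by (fastforce simp: restr_def)
  define k where "k = plen \<mu>"
  have \<mu>_eq: "\<mu> = (gdom G g, prefix k y')"
    using \<mu>(1) g(3) by (simp add: cylinder_def k_def)
  show thesis
  proof (rule that)
    show "disjnt (nbhd (x, m, g, n, y) k) (nbhd (x, m, h, n, y) k)"
    proof (unfold disjnt_iff, intro allI notI, elim conjE)
      fix a assume "a \<in> nbhd (x, m, g, n, y) k" "a \<in> nbhd (x, m, h, n, y) k"
      then obtain x1 y1 x2 y2 where
        t1: "(x1, m + k, lrestr g (prefix k y'), n + k, y1) \<in> tuples E G \<phi>"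
          "a = cls E G \<phi> (x1, m + k, lrestr g (prefix k y'), n + k, y1)"
        and t2: "(x2, m + k, lrestr h (prefix k y'), n + k, y2) \<in> tuples E G \<phi>"
          "a = cls E G \<phi> (x2, m + k, lrestr h (prefix k y'), n + k, y2)"
        using nbhdE[OF t] nbhdE[OF u] unfolding y'_def by metis
      have "((x1, m + k, lrestr g (prefix k y'), n + k, y1), (x2, m + k, lrestr h (prefix k y'), n + k, y2))
          \<in> tuple_rel E G \<phi>"
        using t1(2) t2(2) cls_eq_iff[OF t1(1) t2(1)] by metis
      \<comment> \<open>Both representatives have exponent \<open>n + k\<close> at the source, so
        the two counts in \<open>tuple_rel_iff\<close> coincide.\<close>
      then obtain i where xy: "x1 = x2" "y1 = y2"
        and i: "lrestr (lrestr g (prefix k y')) (prefix i (suffix (n + k) y1))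
          = lrestr (lrestr h (prefix k y')) (prefix i (suffix (n + k) y1))"
        unfolding tuple_rel_iff by auto
      define fs where "fs = prefix i (suffix (n + k) y1)"
      \<comment> \<open>The path \<mu> is prolonged along \<open>y1\<close> to the place where the
        restrictions of \<open>g\<close> and \<open>h\<close> agree. The common range makes their
        actions on \<open>es\<close> agree too, so \<open>q\<close> strongly fixes this extension of
        \<mu>.\<close>
      define es where "es = prefix k y' @ fs"
      have y1: "suffix (n + k) y1 \<in> ipaths E"
        using t1(1) ipaths_suffix by (auto simp: tuples_iff)
      have gk: "lrestr g (prefix k y') \<in> arrs G" "irng E (suffix (n + k) y1) = gdom G (lrestr g (prefix k y'))"
          "suffix (m + k) x1 = iact E \<phi> (lrestr g (prefix k y')) (suffix (n + k) y1)"
        using t1(1) by (auto simp: tuples_iff)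
      have hk: "lrestr h (prefix k y') \<in> arrs G" "irng E (suffix (n + k) y1) = gdom G (lrestr h (prefix k y'))"
          "suffix (m + k) x1 = iact E \<phi> (lrestr h (prefix k y')) (suffix (n + k) y1)"
        using t2(1) xy by (auto simp: tuples_iff)
      have "lact (lrestr g (prefix k y')) fs = lact (lrestr h (prefix k y')) fs"
        using prefix_iact[OF gk(1) y1 gk(2)] prefix_iact[OF hk(1) y1 hk(2)] gk(3) hk(3)
        unfolding fs_def by metis
      then have lact: "lact g es = lact h es"
        using eq[of k] by (simp add: es_def lact_append)
      have fs: "chain E (src E \<mu>) fs"
        using chain_prefix[OF y1, of i] gk(2) lrestr_props[OF g(1) chy[of k]] by (simp add: fs_def \<mu>_eq)
      then have ch: "chain E (gdom G g) es"
        using chy[of k] by (simp add: es_def chain_append \<mu>_eq)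
      have "lrestr g es = lrestr h es"
        using i by (simp add: es_def fs_def)
      then have "strongly_fixed E G \<phi> q (gdom G g, es)"
        using lact_quotient[OF quot ch lact] lrestr_quotient_eq_unit_iff[OF quot ch lact] strongly_fixed_iff[OF q ch]
        by (simp add: q_def)
      moreover have "(gdom G g, es) \<in> extensions E \<mu>"
        using fs by (auto simp: extensions_def es_def \<mu>_eq intro!: exI[of _ "src E \<mu>"] exI[of _ fs])
      ultimately show False
        using \<mu>(2) by blast
    qed
  qed
qed

lemma Hausdorff_ss_topology:
  assumes locally_unfixed
  shows "Hausdorff_space (ss_topology E G \<phi>)"
  unfolding Hausdorff_space_def
proof (intro allI impI, elim conjE)
  fix a b assume a: "a \<in> topspace (ss_topology E G \<phi>)" and b: "b \<in> topspace (ss_topology E G \<phi>)" and ne: "a \<noteq> b"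
  obtain x m g n y where t: "(x, m, g, n, y) \<in> tuples E G \<phi>" "a = cls E G \<phi> (x, m, g, n, y)"
    using topspace_ss_topologyE[OF a] .
  obtain w p h q z where u: "(w, p, h, q, z) \<in> tuples E G \<phi>" "b = cls E G \<phi> (w, p, h, q, z)"
    using topspace_ss_topologyE[OF b] .
  have "\<exists>t u k. t \<in> tuples E G \<phi> \<and> u \<in> tuples E G \<phi> \<and> a = cls E G \<phi> t \<and> b = cls E G \<phi> u \<and> disjnt (nbhd t k) (nbhd u k)"
  proof (cases "x = w \<and> y = z \<and> m + q = n + p")
    case True
    \<comment> \<open>Advancing by \<open>q\<close> and by \<open>n\<close> edges makes both source
      exponents \<open>n + q\<close>; the range exponents \<open>m + q\<close> and
      \<open>p + n\<close> agree because the degrees do.\<close>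
    have t': "(x, m + q, lrestr g (prefix q (suffix n y)), n + q, y) \<in> tuples E G \<phi>"
      and u': "(x, m + q, lrestr h (prefix n (suffix q y)), n + q, y) \<in> tuples E G \<phi>"
      using tuples_shift[OF t(1), of q] tuples_shift[OF u(1), of n] True by (simp_all add: add.commute)
    have a: "a = cls E G \<phi> (x, m + q, lrestr g (prefix q (suffix n y)), n + q, y)"
      and b: "b = cls E G \<phi> (x, m + q, lrestr h (prefix n (suffix q y)), n + q, y)"
      using cls_shift[OF t(1), of q] cls_shift[OF u(1), of n] True t(2) u(2) by (simp_all add: add.commute)
    show ?thesis
      using separate_parallel[OF assms t' u'] t' u' a b ne by metis
  next
    case False
    have "\<exists>k. disjnt (nbhd (x, m, g, n, y) k) (nbhd (w, p, h, q, z) k)"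
    proof (rule ccontr)
      assume contr: "\<nexists>k. disjnt (nbhd (x, m, g, n, y) k) (nbhd (w, p, h, q, z) k)"
      \<comment> \<open>An arrow common to both neighbourhoods has one degree, one range and one
        source; the latter two share their first \<open>k\<close> edges with the paths of both given
        arrows.\<close>
      have *: "m + q = n + p \<and> (\<forall>i<k. x i = w i) \<and> (\<forall>i<k. y i = z i)" for k
      proof -
        obtain c where c: "c \<in> nbhd (x, m, g, n, y) k" "c \<in> nbhd (w, p, h, q, z) k"
          using contr by (auto simp: disjnt_iff)
        obtain g' h' x1 y1 x2 y2 where
          1: "(x1, m + k, g', n + k, y1) \<in> tuples E G \<phi>" "c = cls E G \<phi> (x1, m + k, g', n + k, y1)"
            "prefix (m + k) x1 = prefix (m + k) x" "prefix (n + k) y1 = prefix (n + k) y"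
          and 2: "(x2, p + k, h', q + k, y2) \<in> tuples E G \<phi>" "c = cls E G \<phi> (x2, p + k, h', q + k, y2)"
            "prefix (p + k) x2 = prefix (p + k) w" "prefix (q + k) y2 = prefix (q + k) z"
          using nbhdE[OF t(1) c(1)] nbhdE[OF u(1) c(2)] by metis
        have nth: "v i = v' i" if "prefix (j + k) v = prefix (j + k) v'" "i < k" for v v' :: "'e word" and i j
          using arg_cong[OF that(1), of "\<lambda>l. l ! i"] that(2) by simp
        have "((x1, m + k, g', n + k, y1), (x2, p + k, h', q + k, y2)) \<in> tuple_rel E G \<phi>"
          using 1(1,2) 2(1,2) cls_eq_iff by metis
        then have "x1 = x2" "y1 = y2" "m + q = n + p"
          by (auto simp: tuple_rel_iff)
        then show ?thesis
          using nth[OF 1(3)] nth[OF 1(4)] nth[OF 2(3)] nth[OF 2(4)] by auto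
      qed
      have "x i = w i \<and> y i = z i" for i
        using *[of "Suc i"] by simp
      then have "x = w" "y = z"
        by auto
      then show False
        using * False by blast
    qed
    then show ?thesis
      using t u by blast
  qed
  then obtain t u k where "t \<in> tuples E G \<phi>" "u \<in> tuples E G \<phi>" "a = cls E G \<phi> t" "b = cls E G \<phi> u"
    "disjnt (nbhd t k) (nbhd u k)"
    by blast
  then show "\<exists>U V. openin (ss_topology E G \<phi>) U \<and> openin (ss_topology E G \<phi>) V \<and> a \<in> U \<and> b \<in> V \<and> disjnt U V"
    using openin_nbhd cls_in_nbhd by (cases t; cases u) metis
qed

section \<open>The Hausdorff property of the transformation arrows implies condition (4)\<close>

lemma transformation_tuple_in_tuples:
  assumes "g \<in> arrs G" "y \<in> ipaths E" "irng E y = gdom G g"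
  shows "(iact E \<phi> g y, 0, g, 0, y) \<in> tuples E G \<phi>"
  using assms by (simp add: tuples_iff iact_in_ipaths)

text \<open>Continuity at \<open>y\<close> of the section determined by \<open>g\<close>. Induction
  over the generated topology reduces it to one set Z(\<mu>, h, \<nu>): where \<open>g\<close> and
  \<open>h\<close> have equal restrictions along \<open>y\<close>, they still do along any
  \<open>z\<close> with the same prefix.\<close>

lemma transformation_continuous:
  assumes g: "g \<in> arrs G" and y: "y \<in> ipaths E" "irng E y = gdom G g"
    and U: "openin (ss_topology E G \<phi>) U" "cls E G \<phi> (iact E \<phi> g y, 0, g, 0, y) \<in> U"
  shows "\<exists>n. \<forall>z\<in>ipaths E. irng E z = gdom G g \<longrightarrow> prefix n z = prefix n y \<longrightarrow>
    cls E G \<phi> (iact E \<phi> g z, 0, g, 0, z) \<in> U"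
  using U unfolding ss_topology_def openin_topology_generated_by_iff
proof (induction rule: generate_topology_on.induct)
  case (Int U V)
  then obtain m n where
    m: "\<And>z. z \<in> ipaths E \<Longrightarrow> irng E z = gdom G g \<Longrightarrow> prefix m z = prefix m y \<Longrightarrow>
      cls E G \<phi> (iact E \<phi> g z, 0, g, 0, z) \<in> U"
    and n: "\<And>z. z \<in> ipaths E \<Longrightarrow> irng E z = gdom G g \<Longrightarrow> prefix n z = prefix n y \<Longrightarrow>
      cls E G \<phi> (iact E \<phi> g z, 0, g, 0, z) \<in> V"
    by auto
  have mono: "prefix i z = prefix i y" if "prefix (max m n) z = prefix (max m n) y" "i \<le> max m n" for z i
    using arg_cong[OF that(1), of "take i"] that(2) by (simp add: min_def)
  show ?case
    by (rule exI[of _ "max m n"]) (auto intro!: m n mono)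
next
  case (UN K)
  then obtain k where "k \<in> K" "cls E G \<phi> (iact E \<phi> g y, 0, g, 0, y) \<in> k"
    by blast
  then show ?case
    using UN.IH by (meson UnionI)
next
  case (Basis s)
  then obtain v es h w fs where s: "s = Zset E G \<phi> (v, es) h (w, fs)"
    and ch: "chain E v es" "chain E w fs" "h \<in> arrs G" "src E (v, es) = gcod G h" "src E (w, fs) = gdom G h"
    by auto
  then obtain y' where y': "y' \<in> ipaths E" "irng E y' = gdom G h"
    and cls: "cls E G \<phi> (iact E \<phi> g y, 0, g, 0, y)
      = cls E G \<phi> (es \<frown> iact E \<phi> h y', length es, h, length fs, fs \<frown> y')"
    using Basis.prems by (auto simp: Zset_def)
  have "((iact E \<phi> g y, 0, g, 0, y), (es \<frown> iact E \<phi> h y', length es, h, length fs, fs \<frown> y')) \<in> tuple_rel E G \<phi>"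
    using cls cls_eq_iff[OF transformation_tuple_in_tuples[OF g y] Zset_tuple_in_tuples[OF ch y']] by simp
  then obtain i j where gy: "iact E \<phi> g y = es \<frown> iact E \<phi> h y'" and y_eq: "y = fs \<frown> y'"
    and eqs: "0 + length fs = 0 + length es" "0 + i = length fs + j"
      "lrestr g (prefix i (suffix 0 y)) = lrestr h (prefix j (suffix (length fs) y))"
    unfolding tuple_rel_iff by blast
  have suf_y: "suffix (length fs) y = y'"
    by (simp add: y_eq)
  have len: "length es = length fs" and ij: "i = length fs + j"
    using eqs by simp_all
  have restr_eq: "lrestr g (prefix i y) = lrestr h (prefix j y')"
    using eqs(3) unfolding suf_y suffix_0 .
  \<comment> \<open>Position \<open>i\<close> is where the restrictions of \<open>g\<close> and
    \<open>h\<close> agree; as \<open>i = length fs + j\<close>, a prefix of that length also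
    contains \<open>fs\<close>.\<close>
  show ?case
  proof (intro exI[of _ i] ballI impI)
    fix z assume z: "z \<in> ipaths E" "irng E z = gdom G g" and pre: "prefix i z = prefix i y"
    define z' where "z' = suffix (length fs) z"
    have pre_z: "prefix (length fs) z = fs" and pre_z': "prefix j z' = prefix j y'"
      using arg_cong[OF pre, of "take (length fs)"] arg_cong[OF pre, of "drop (length fs)"]
      by (simp_all add: y_eq ij z'_def)
    then have z_eq: "z = fs \<frown> z'"
      using prefix_suffix[of z "length fs"] by (simp add: z'_def)
    have "irng E y = w"
      using conc_in_ipaths[OF ch(2) y'(1)] y'(2) ch(5) y_eq by simp
    then have z': "z' \<in> ipaths E" "irng E z' = gdom G h"
      using src_prefix[OF z(1), of "length fs"] ipaths_suffix[OF z(1)] pre_z z(2) y(2) ch(5)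
      by (simp_all add: z'_def)
    \<comment> \<open>The image of \<open>z\<close> is compared in two pieces: up to
      \<open>i\<close> it agrees with the image of \<open>y\<close>, and behind \<open>i\<close>
      equal restrictions act on the same tail.\<close>
    have "prefix i (iact E \<phi> g z) = prefix i (iact E \<phi> g y)"
      using prefix_iact g y z pre by simp
    also have "\<dots> = es @ prefix j (iact E \<phi> h y')"
      by (simp add: gy ij len)
    also have "\<dots> = es @ prefix j (iact E \<phi> h z')"
      using prefix_iact[OF ch(3)] y' z' pre_z' by simp
    finally have 1: "prefix i (iact E \<phi> g z) = es @ prefix j (iact E \<phi> h z')" .
    have "suffix i z = suffix j z'"
      by (simp add: z'_def ij)
    then have "suffix i (iact E \<phi> g z) = suffix j (iact E \<phi> h z')"
      using suffix_iact[OF g z] suffix_iact[OF ch(3) z'] restr_eq pre pre_z' by simp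
    then have gz: "iact E \<phi> g z = es \<frown> iact E \<phi> h z'"
      using prefix_suffix[of "iact E \<phi> g z" i] 1 prefix_suffix[of "iact E \<phi> h z'" j]
      by (metis conc_conc)
    have "cls E G \<phi> (iact E \<phi> g z, 0, g, 0, z)
      = cls E G \<phi> (es \<frown> iact E \<phi> h z', length es, h, length fs, fs \<frown> z')"
      unfolding cls_eq_iff[OF transformation_tuple_in_tuples[OF g z] Zset_tuple_in_tuples[OF ch z']] tuple_rel_iff
    proof (intro conjI)
      have "lrestr g (prefix i (suffix 0 z)) = lrestr h (prefix j (suffix (length fs) z))"
        using restr_eq pre pre_z' by (simp add: z'_def del: subsequence_shift)
      then show "\<exists>i j. 0 + i = length fs + j
          \<and> lrestr g (prefix i (suffix 0 z)) = lrestr h (prefix j (suffix (length fs) z))"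
        using ij by (intro exI[of _ i] exI[of _ j] conjI) simp_all
    qed (use transformation_tuple_in_tuples[OF g z] Zset_tuple_in_tuples[OF ch z'] gz z_eq len in auto)
    then show "cls E G \<phi> (iact E \<phi> g z, 0, g, 0, z) \<in> s"
      using z' ch(5) unfolding s Zset_def by auto
  qed
qed auto

lemma cls_transformation_in_topspace:
  assumes "g \<in> arrs G" "y \<in> ipaths E" "irng E y = gdom G g"
  shows "cls E G \<phi> (iact E \<phi> g y, 0, g, 0, y) \<in> topspace (ss_topology E G \<phi>)"
  using openin_nbhd cls_in_nbhd transformation_tuple_in_tuples[OF assms] openin_subset by blast

text \<open>Separate the arrows of \<open>g\<close> and of the unit at \<open>y\<close> by open
  sets. Continuity yields a prefix of \<open>y\<close> beyond which the arrows of \<open>g\<close>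
  and of the unit stay in their sets; a strongly fixed extension of it would give one arrow in
  both.\<close>

lemma locally_unfixed_if_Hausdorff_transformation:
  assumes ns: "no_sources E"
    and H: "Hausdorff_space (subtopology (ss_topology E G \<phi>) (transformation_arrs E G \<phi>))"
  shows locally_unfixed
  unfolding locally_unfixed_def
proof (intro ballI impI, elim conjE)
  fix g y assume g: "g \<in> arrs G" and y: "y \<in> ipaths E" "irng E y = gdom G g" and fix_y: "iact E \<phi> g y = y"
    and nonunit: "\<forall>n. restr E G \<phi> g (seg E y 0 n) \<noteq> gunit G (src E (seg E y 0 n))"
  define v where "v = gdom G g"
  define u where "u = gunit G v"
  \<comment> \<open>Since \<open>g\<close> fixes \<open>y\<close>, its codomain is the range of
    \<open>y\<close>, so \<open>g\<close> is parallel to the unit \<open>u\<close>.\<close>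
  have v: "v \<in> objs G" "gcod G g = v"
    using g y fix_y irng_iact[OF g y] gdom_in[OF g] by (simp_all add: v_def)
  have u: "u \<in> arrs G" "gdom G u = v" "gcod G u = v"
    using v by (auto simp: u_def gunit_in gdom_unit gcod_unit)
  have iact_u: "iact E \<phi> u z = z" if "z \<in> ipaths E" "irng E z = v" for z
    using iact_gunit[OF that(1)] that(2) by (simp add: u_def)
  have lrestr_u: "lrestr u (prefix n z) = gunit G (src E (v, prefix n z))" if "z \<in> ipaths E" "irng E z = v" for z n
    using lrestr_gunit[of v "prefix n z"] chain_prefix[OF that(1)] that(2) by (simp add: u_def)
  let ?c = "\<lambda>g z. cls E G \<phi> (iact E \<phi> g z, 0, g, 0, z)"
  have tr: "?c k z \<in> transformation_arrs E G \<phi>"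
    if "k \<in> arrs G" "z \<in> ipaths E" "irng E z = gdom G k" for k z
    using that unfolding transformation_arrs_def by fastforce
  \<comment> \<open>Both tuples have the same paths and exponents \<open>0\<close>, and restrictions
    of \<open>u\<close> are units, so only the restrictions of \<open>g\<close> matter.\<close>
  have eq_iff: "?c g z = ?c u z \<longleftrightarrow> (\<exists>n. lrestr g (prefix n z) = gunit G (src E (v, prefix n z)))"
    if "z \<in> ipaths E" "irng E z = v" "iact E \<phi> g z = z" for z
    using transformation_tuple_in_tuples[of g z] transformation_tuple_in_tuples[of u z] that g u lrestr_u[OF that(1,2)]
    by (simp add: cls_eq_iff tuple_rel_iff iact_u v_def)
  have "?c g y \<noteq> ?c u y"
    using eq_iff[OF y(1)] y(2) fix_y nonunit by (simp add: v_def)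
  then obtain U' V' where UV': "openin (subtopology (ss_topology E G \<phi>) (transformation_arrs E G \<phi>)) U'"
    "openin (subtopology (ss_topology E G \<phi>) (transformation_arrs E G \<phi>)) V'"
    "?c g y \<in> U'" "?c u y \<in> V'" "disjnt U' V'"
    using H cls_transformation_in_topspace[OF g y] cls_transformation_in_topspace[OF u(1) y(1)]
      tr[OF g y] tr[OF u(1) y(1)] y(2) u(2) unfolding Hausdorff_space_def by (simp add: v_def) metis
  then obtain U V where UV: "openin (ss_topology E G \<phi>) U" "openin (ss_topology E G \<phi>) V"
    "U' = U \<inter> transformation_arrs E G \<phi>" "V' = V \<inter> transformation_arrs E G \<phi>"
    by (auto simp: openin_subtopology)
  obtain m where m: "\<And>z. z \<in> ipaths E \<Longrightarrow> irng E z = v \<Longrightarrow> prefix m z = prefix m y \<Longrightarrow> ?c g z \<in> U"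
    using transformation_continuous[OF g y UV(1)] UV' UV by (auto simp: v_def)
  obtain n where n: "\<And>z. z \<in> ipaths E \<Longrightarrow> irng E z = v \<Longrightarrow> prefix n z = prefix n y \<Longrightarrow> ?c u z \<in> V"
    using transformation_continuous[OF u(1) y(1) _ UV(2)] UV' UV y(2) u(2) by (auto simp: v_def)
  \<comment> \<open>Agreement with \<open>y\<close> on this many edges puts the two arrows at
    \<open>z\<close> into \<open>U\<close> and \<open>V\<close> respectively.\<close>
  let ?l = "max m n"
  let ?\<mu> = "(v, prefix ?l y)"
  have "\<not> strongly_fixed E G \<phi> g \<nu>" if ext: "\<nu> \<in> extensions E ?\<mu>" for \<nu>
  proof
    assume sf: "strongly_fixed E G \<phi> g \<nu>"
    obtain fs where \<nu>: "\<nu> = (v, prefix ?l y @ fs)" "chain E (src E ?\<mu>) fs"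
      using ext by (auto simp: extensions_def elim!: paths_atE)
    define es where "es = prefix ?l y @ fs"
    have ch: "chain E v es"
      using \<nu>(2) chain_prefix[OF y(1), of ?l] y(2) by (simp add: es_def chain_append v_def)
    then have fixed: "lact g es = es" "lrestr g es = gunit G (src E (v, es))"
      using sf strongly_fixed_iff[OF g _ _ ch] v \<nu>(1) by (auto simp: v_def es_def)
    have vs: "src E (v, es) \<in> verts E"
      using chain_src_in_verts[OF ch] .
    obtain x where x: "x \<in> ipaths E" "irng E x = src E (v, es)"
      using ex_ipath_at[OF wf ns vs] .
    \<comment> \<open>Any infinite continuation of \<open>es\<close> is fixed by \<open>g\<close>:
      the prefix \<open>es\<close> is fixed, and the restriction to it is a unit, which fixes
      \<open>x\<close>.\<close>
    define z where "z = es \<frown> x"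
    have z: "z \<in> ipaths E" "irng E z = v"
      using conc_in_ipaths[OF ch x] by (auto simp: z_def)
    have z': "irng E z = gdom G g"
      using z by (simp add: v_def)
    have pre_z: "prefix (length es) z = es" and suf_z: "suffix (length es) z = x"
      by (simp_all add: z_def)
    have "prefix (length es) (iact E \<phi> g z) = es" "suffix (length es) (iact E \<phi> g z) = x"
      using prefix_iact[OF g z(1) z'] suffix_iact[OF g z(1) z'] fixed pre_z suf_z iact_gunit[OF x(1)] x(2)
      by simp_all
    then have fix_z: "iact E \<phi> g z = z"
      using prefix_suffix[of "iact E \<phi> g z" "length es"] by (simp add: z_def)
    have eq: "?c g z = ?c u z"
      using eq_iff[OF z fix_z] fixed pre_z by metis
    have pre: "prefix i z = prefix i y" if "i \<le> ?l" for i
      using that by (simp add: z_def es_def min_def)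
    have "?c g z \<in> U" "?c u z \<in> V"
      using m[OF z pre] n[OF z pre] by simp_all
    then have "?c g z \<in> U' \<inter> V'"
      using eq tr[OF g z(1) z'] UV by simp
    then show False
      using UV'(5) by (auto simp: disjnt_iff)
  qed
  moreover have "?\<mu> \<in> fpaths E" "y \<in> cylinder E ?\<mu>"
    using y chain_prefix[OF y(1), of ?l] by (auto simp: cylinder_def v_def)
  ultimately show "\<exists>\<mu>\<in>fpaths E. y \<in> cylinder E \<mu> \<and> \<not> (\<exists>\<nu>\<in>extensions E \<mu>. strongly_fixed E G \<phi> g \<nu>)"
    by blast
qed

section \<open>Comparing the subgroupoids and closing the cycle of implications\<close>

lemma transformation_arrs_subset_core_arrs: "transformation_arrs E G \<phi> \<subseteq> core_arrs E G \<phi>"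
proof
  fix a assume "a \<in> transformation_arrs E G \<phi>"
  then obtain g x where g: "g \<in> arrs G" "x \<in> ipaths E" "irng E x = gdom G g"
    and a: "a = cls E G \<phi> (iact E \<phi> g x, 0, g, 0, x)"
    by (auto simp: transformation_arrs_def)
  then have "a \<in> arrs (ss_groupoid E G \<phi>)"
    using transformation_tuple_in_tuples[OF g] by (auto simp: ss_groupoid_def cls_def intro: quotientI)
  then show "a \<in> core_arrs E G \<phi>"
    using a unfolding core_arrs_def by blast
qed

text \<open>A strongly fixed initial segment of \<open>y\<close> has a unit as restriction, so the
  premises of condition (4) are never met.\<close>

lemma locally_unfixed_if_regular: "regular_action E G \<phi> \<Longrightarrow> locally_unfixed"
  unfolding regular_action_def locally_unfixed_def strongly_fixed_def by blast

end

theorem corollary6p7: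
  fixes E :: "('v,'e) pre_digraph"
    and G :: "('v,'g) groupoid"
    and \<phi> :: "'g \<Rightarrow> ('v,'e) piso"
  assumes "fin_digraph E"
    and "no_sources E"
    and "self_similar_action E G \<phi>"
  defines "S1 \<equiv> Hausdorff_space (ss_topology E G \<phi>)"
    and "S2 \<equiv> Hausdorff_space (subtopology (ss_topology E G \<phi>) (core_arrs E G \<phi>))"
    and "S3 \<equiv> Hausdorff_space (subtopology (ss_topology E G \<phi>) (transformation_arrs E G \<phi>))"
    and "S4 \<equiv> (\<forall>g\<in>arrs G. \<forall>y\<in>ipaths E.
             irng E y = gdom G g \<and> iact E \<phi> g y = y \<and>
             (\<forall>n. restr E G \<phi> g (seg E y 0 n) \<noteq> gunit G (src E (seg E y 0 n))) \<longrightarrow>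
             (\<exists>\<mu>\<in>fpaths E. y \<in> cylinder E \<mu> \<and> \<not> (\<exists>\<nu>\<in>extensions E \<mu>. strongly_fixed E G \<phi> g \<nu>)))"
  shows "(S1 \<longleftrightarrow> S2) \<and> (S2 \<longleftrightarrow> S3) \<and> (S3 \<longleftrightarrow> S4) \<and>
         (regular_action E G \<phi> \<longrightarrow> Hausdorff_space (ss_topology E G \<phi>))"
proof -
  interpret self_similar_action E G \<phi>
    by (rule assms(3))
  interpret self_similar_graph_action E G \<phi>
    using assms(1) by (intro self_similar_graph_action.intro self_similar_graph_action_axioms.intro assms(3) fin_digraph.axioms(1))
  have "S4 \<longleftrightarrow> locally_unfixed"
    unfolding S4_def locally_unfixed_def ..
  moreover have "S1 \<Longrightarrow> S2"
    unfolding S1_def S2_def by (rule Hausdorff_space_subtopology)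
  \<comment> \<open>The space of (3) is a subspace of that of (2), so its topology can be induced in
    two stages.\<close>
  moreover have "S2 \<Longrightarrow> S3"
    using Hausdorff_space_subtopology[of "subtopology (ss_topology E G \<phi>) (core_arrs E G \<phi>)" "transformation_arrs E G \<phi>"]
    unfolding S2_def S3_def subtopology_subtopology
    by (simp add: inf.absorb2 transformation_arrs_subset_core_arrs)
  moreover have "S3 \<Longrightarrow> locally_unfixed"
    unfolding S3_def by (rule locally_unfixed_if_Hausdorff_transformation[OF assms(2)])
  moreover have "locally_unfixed \<Longrightarrow> S1"
    unfolding S1_def by (rule Hausdorff_ss_topology)
  ultimately show ?thesis
    using locally_unfixed_if_regular S1_def by blast
qed

end
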